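(* Let $\phi\colon\mathbb{D}\to\mathbb{D}$ be an analytic self-map and assume there exists $w_0\in H^2$, $w_0\not\equiv0$, such that $M_{w_0}C_\phi\colon f\mapsto w_0\,(f\circ\phi)$ is a Hilbert–Schmidt operator on $H^2$. Then there exists $w\in H^2$, $w\not\equiv 0$, such that $M_wC_\phi$ is bounded on $H^2$ and $M_wC_\phi\in S_p(H^2)$ for every $p<2$ (with $p>0$).
   Context: $\mathbb{D}$ is the open unit disk, $H^2$ the Hardy space. $S_p(H^2)$, $p>0$, is the Schatten class of compact operators $T$ on $H^2$ with $\sum_n s_n(T)^p<\infty$ ($s_n$ the singular numbers). *)

theory Defs
  imports "HOL-Complex_Analysis.Complex_Analysis"
begin

text \<open>Functions on the unit disk are represented as total maps complex => complex;
  only their values on the open unit disk matter.\<close>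

abbreviation disk :: "complex set" where
  "disk \<equiv> ball 0 1"

definition taylor_coeff :: "(complex \<Rightarrow> complex) \<Rightarrow> nat \<Rightarrow> complex" where
  "taylor_coeff f n = (deriv ^^ n) f 0 / of_nat (fact n)"

definition H2 :: "(complex \<Rightarrow> complex) set" where
  "H2 = {f. f holomorphic_on disk \<and> summable (\<lambda>n. (cmod (taylor_coeff f n))\<^sup>2)}"

definition h2_norm :: "(complex \<Rightarrow> complex) \<Rightarrow> real" where
  "h2_norm f = sqrt (\<Sum>n. (cmod (taylor_coeff f n))\<^sup>2)"

definition wcomp :: "(complex \<Rightarrow> complex) \<Rightarrow> (complex \<Rightarrow> complex) \<Rightarrow>
    (complex \<Rightarrow> complex) \<Rightarrow> (complex \<Rightarrow> complex)" where
  "wcomp w \<phi> f = (\<lambda>z. w z * f (\<phi> z))"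

definition linear_on_H2 :: "((complex \<Rightarrow> complex) \<Rightarrow> (complex \<Rightarrow> complex)) \<Rightarrow> bool" where
  "linear_on_H2 T \<longleftrightarrow>
     (\<forall>f\<in>H2. \<forall>g\<in>H2. \<forall>a b. \<forall>z\<in>disk.
        T (\<lambda>x. a * f x + b * g x) z = a * T f z + b * T g z)"

definition bounded_on_H2 :: "((complex \<Rightarrow> complex) \<Rightarrow> (complex \<Rightarrow> complex)) \<Rightarrow> bool" where
  "bounded_on_H2 T \<longleftrightarrow> linear_on_H2 T \<and> (\<forall>f\<in>H2. T f \<in> H2) \<and>
     (\<exists>C. \<forall>f\<in>H2. h2_norm (T f) \<le> C * h2_norm f)"

definition op_norm_H2 :: "((complex \<Rightarrow> complex) \<Rightarrow> (complex \<Rightarrow> complex)) \<Rightarrow> real" where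
  "op_norm_H2 T = Sup {h2_norm (T f) | f. f \<in> H2 \<and> h2_norm f \<le> 1}"

definition rank_le_H2 :: "nat \<Rightarrow> ((complex \<Rightarrow> complex) \<Rightarrow> (complex \<Rightarrow> complex)) \<Rightarrow> bool" where
  "rank_le_H2 n R \<longleftrightarrow> (\<exists>(g :: nat \<Rightarrow> complex \<Rightarrow> complex) (c :: (complex \<Rightarrow> complex) \<Rightarrow> nat \<Rightarrow> complex).
     \<forall>f\<in>H2. \<forall>z\<in>disk. R f z = (\<Sum>i<n. c f i * g i z))"

text \<open>Singular numbers s_0(T) >= s_1(T) >= ... (indexed from 0), given as approximation
  numbers s_n(T) = inf { ||T - R|| : R bounded of rank <= n }, which coincide with the
  singular numbers of a bounded operator on a Hilbert space.\<close>
definition sing_num :: "((complex \<Rightarrow> complex) \<Rightarrow> (complex \<Rightarrow> complex)) \<Rightarrow> nat \<Rightarrow> real" where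
  "sing_num T n = Inf {op_norm_H2 (\<lambda>f z. T f z - R f z) | R.
       bounded_on_H2 R \<and> rank_le_H2 n R}"

definition compact_on_H2 :: "((complex \<Rightarrow> complex) \<Rightarrow> (complex \<Rightarrow> complex)) \<Rightarrow> bool" where
  "compact_on_H2 T \<longleftrightarrow> bounded_on_H2 T \<and>
     (\<forall>f :: nat \<Rightarrow> complex \<Rightarrow> complex. (\<forall>n. f n \<in> H2) \<and> (\<exists>B. \<forall>n. h2_norm (f n) \<le> B) \<longrightarrow>
        (\<exists>r g. strict_mono r \<and> g \<in> H2 \<and>
           (\<lambda>n. h2_norm (\<lambda>z. T (f (r n)) z - g z)) \<longlonglongrightarrow> 0))"

definition schatten_H2 :: "real \<Rightarrow> ((complex \<Rightarrow> complex) \<Rightarrow> (complex \<Rightarrow> complex)) \<Rightarrow> bool" where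
  "schatten_H2 p T \<longleftrightarrow> compact_on_H2 T \<and> summable (\<lambda>n. sing_num T n powr p)"

definition hilbert_schmidt_H2 :: "((complex \<Rightarrow> complex) \<Rightarrow> (complex \<Rightarrow> complex)) \<Rightarrow> bool" where
  "hilbert_schmidt_H2 T \<longleftrightarrow> bounded_on_H2 T \<and>
     summable (\<lambda>n. (h2_norm (T (\<lambda>z. z ^ n)))\<^sup>2)"

end

theory Submission
  imports Defs
begin

text \<open>
  For a polynomial \<open>f\<close>, the trigonometric polynomial \<open>|f|\<^sup>2\<close> on the unit circle is the real part of
  an explicit polynomial \<open>F\<close> with \<open>F 0 = \<parallel>f\<parallel>\<^sup>2\<close>, and \<open>|f|\<^sup>2 \<le> Re F\<close> on the disk. Together with
  dilations and the maximum principle, these polynomials replace boundary values and Poisson integrals.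

  The Hilbert-Schmidt hypothesis says that \<open>|w\<^sub>0|\<^sup>2 / (1 - |\<phi>|\<^sup>2)\<close> is integrable on the circle. Since
  \<open>log |w\<^sub>0|\<close> is integrable, so is \<open>log (1 / (1 - |\<phi>|\<^sup>2))\<close>, i.e. \<open>\<Sum> \<parallel>\<phi>\<^sup>n\<parallel>\<^sup>2 / n\<close> converges. Then
  \<open>\<Sum> a\<^sub>n \<parallel>\<phi>\<^sup>n\<parallel>\<^sup>2 / n\<close> still converges for some \<open>a\<^sub>n\<close> tending to infinity, and the function
  \<open>\<Sum> a\<^sub>n |\<phi>|\<^bsup>2n\<^esup> / n\<close> has a harmonic majorant \<open>Re F\<close> on the disk. The weight \<open>w = exp (- F)\<close> decays
  faster than every power of \<open>1 - |\<phi>|\<^sup>2\<close>, which makes the truncations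
  \<open>f \<mapsto> w (f\<^sub>n \<circ> \<phi>)\<close>, with \<open>f\<^sub>n\<close> the Taylor polynomials of \<open>f\<close>, approximate
  \<open>f \<mapsto> w (f \<circ> \<phi>)\<close> in operator norm faster than every power of \<open>1 / n\<close>.
\<close>

section \<open>Harmonic majorants of squared polynomials\<close>

text \<open>On the circle \<open>cnj z\<close> is \<open>1 / z\<close>, so in the double sum for the
  squared modulus the terms at \<open>(j, k)\<close> and \<open>(k, j)\<close> are conjugate and add
  up to twice a real part. Keeping the one with \<open>k < j\<close> leaves only nonnegative powers
  of \<open>z\<close>.\<close>

definition majorant_poly :: "(nat \<Rightarrow> complex) \<Rightarrow> nat \<Rightarrow> complex \<Rightarrow> complex" where
  "majorant_poly c N z =
     (\<Sum>j<N. of_real ((cmod (c j))\<^sup>2) + 2 * (\<Sum>k<j. c j * cnj (c k) * z ^ (j - k)))"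

lemma majorant_poly_holomorphic [holomorphic_intros]: "majorant_poly c N holomorphic_on A"
  unfolding majorant_poly_def by (intro holomorphic_intros)

lemma majorant_poly_0: "majorant_poly c N 0 = of_real (\<Sum>j<N. (cmod (c j))\<^sup>2)"
proof -
  have "(\<Sum>k<j. c j * cnj (c k) * 0 ^ (j - k)) = 0" for j
    by (intro sum.neutral) auto
  then show ?thesis
    by (simp add: majorant_poly_def)
qed

lemma Re_majorant_poly_circle:
  assumes "cmod z = 1"
  shows "Re (majorant_poly c N z) = (cmod (\<Sum>j<N. c j * z ^ j))\<^sup>2"
proof (induction N)
  case 0
  show ?case by (simp add: majorant_poly_def)
next
  case (Suc N)
  let ?s = "\<Sum>j<N. c j * z ^ j"
  have zz: "z * cnj z = 1"
    using assms by (simp add: complex_norm_square[symmetric])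
  have pow: "z ^ N * cnj z ^ k = z ^ (N - k)" if "k < N" for k
  proof -
    have "z ^ N * cnj z ^ k = z ^ (N - k) * (z * cnj z) ^ k"
      using that by (simp add: power_mult_distrib flip: power_add)
    then show ?thesis by (simp add: zz)
  qed
  have "c N * z ^ N * cnj ?s = (\<Sum>k<N. c N * cnj (c k) * (z ^ N * cnj z ^ k))"
    by (simp add: sum_distrib_left algebra_simps)
  also have "\<dots> = (\<Sum>k<N. c N * cnj (c k) * z ^ (N - k))"
    by (intro sum.cong) (use pow in auto)
  finally have cross: "(\<Sum>k<N. c N * cnj (c k) * z ^ (N - k)) = c N * z ^ N * cnj ?s" ..
  have sq: "(cmod (x + y))\<^sup>2 = (cmod x)\<^sup>2 + (cmod y)\<^sup>2 + 2 * Re (y * cnj x)" for x y :: complex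
    unfolding cmod_power2 by (simp add: power2_eq_square algebra_simps)
  have "(cmod (c N * z ^ N))\<^sup>2 = (cmod (c N))\<^sup>2"
    using assms by (simp add: norm_mult norm_power)
  then have "(cmod (\<Sum>j<Suc N. c j * z ^ j))\<^sup>2 =
      (cmod ?s)\<^sup>2 + (cmod (c N))\<^sup>2 + 2 * Re (c N * z ^ N * cnj ?s)"
    using sq[of ?s "c N * z ^ N"] by simp
  moreover have "majorant_poly c (Suc N) z =
      majorant_poly c N z + (of_real ((cmod (c N))\<^sup>2) + 2 * (c N * z ^ N * cnj ?s))"
    unfolding majorant_poly_def by (simp only: cross sum.lessThan_Suc)
  ultimately show ?case
    using Suc.IH by simp
qed

lemma Re_le_of_circle:
  assumes "f holomorphic_on UNIV" "\<And>z. cmod z = 1 \<Longrightarrow> Re (f z) \<le> B" "cmod z \<le> 1"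
  shows "Re (f z) \<le> B"
  by (rule maximum_real_frontier[of f "cball 0 1"])
     (use assms in \<open>auto intro: holomorphic_on_subset holomorphic_on_imp_continuous_on\<close>)

text \<open>Since \<open>|f|\<^sup>2 \<ge> Re (2 \<lambda>\<^sup>* f) - |\<lambda>|\<^sup>2\<close> with equality where \<open>f = \<lambda>\<close>, the maximum
  principle for \<open>2 \<lambda>\<^sup>* f - F\<close> suffices.\<close>
lemma Re_majorant_poly_ge:
  assumes "cmod z \<le> 1"
  shows "(cmod (\<Sum>j<N. c j * z ^ j))\<^sup>2 \<le> Re (majorant_poly c N z)"
proof -
  define p where "p = (\<lambda>z. \<Sum>j<N. c j * z ^ j)"
  define l where "l = p z"
  have sq: "2 * Re (cnj l * x) - (cmod x)\<^sup>2 \<le> (cmod l)\<^sup>2" for x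
  proof -
    have "0 \<le> (cmod (x - l))\<^sup>2" by simp
    then show ?thesis
      unfolding cmod_power2 by (simp add: power2_eq_square algebra_simps)
  qed
  have "Re (2 * cnj l * p z - majorant_poly c N z) \<le> (cmod l)\<^sup>2"
  proof (rule Re_le_of_circle[where f = "\<lambda>z. 2 * cnj l * p z - majorant_poly c N z"])
    show "(\<lambda>z. 2 * cnj l * p z - majorant_poly c N z) holomorphic_on UNIV"
      unfolding p_def by (intro holomorphic_intros)
    fix u :: complex assume "cmod u = 1"
    then have "Re (majorant_poly c N u) = (cmod (p u))\<^sup>2"
      unfolding p_def by (rule Re_majorant_poly_circle)
    then show "Re (2 * cnj l * p u - majorant_poly c N u) \<le> (cmod l)\<^sup>2"
      using sq[of "p u"] by (simp add: algebra_simps)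
  qed fact
  moreover have "Re (2 * cnj l * p z) = 2 * (cmod l)\<^sup>2"
    unfolding l_def cmod_power2 by (simp add: power2_eq_square)
  ultimately show ?thesis
    by (simp add: l_def p_def)
qed

section \<open>Taylor coefficients and the Hardy space\<close>

lemma taylor_sums:
  assumes "f holomorphic_on disk" "z \<in> disk"
  shows "(\<lambda>n. taylor_coeff f n * z ^ n) sums f z"
  using holomorphic_power_series[OF assms] by (simp add: taylor_coeff_def)

lemma taylor_coeff_lincomb:
  assumes "f holomorphic_on disk" "g holomorphic_on disk"
  shows "taylor_coeff (\<lambda>z. a * f z + b * g z) n = a * taylor_coeff f n + b * taylor_coeff g n"
proof -
  have "(deriv ^^ n) (\<lambda>z. a * f z + b * g z) 0 =
      (deriv ^^ n) (\<lambda>z. a * f z) 0 + (deriv ^^ n) (\<lambda>z. b * g z) 0"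
    using assms by (intro higher_deriv_add[where S = disk] holomorphic_intros) auto
  also have "\<dots> = a * (deriv ^^ n) f 0 + b * (deriv ^^ n) g 0"
    using higher_deriv_cmult[OF assms(1)] higher_deriv_cmult[OF assms(2)] by auto
  finally show ?thesis
    by (simp add: taylor_coeff_def add_divide_distrib)
qed

lemma taylor_coeff_diff:
  assumes "f holomorphic_on disk" "g holomorphic_on disk"
  shows "taylor_coeff (\<lambda>z. f z - g z) n = taylor_coeff f n - taylor_coeff g n"
  using taylor_coeff_lincomb[OF assms, of 1 "-1"] by simp

lemma H2_D:
  assumes "f \<in> H2"
  shows "f holomorphic_on disk" "summable (\<lambda>n. (cmod (taylor_coeff f n))\<^sup>2)"
  using assms by (auto simp: H2_def)

lemma h2_norm_sq:
  assumes "f \<in> H2"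
  shows "(h2_norm f)\<^sup>2 = (\<Sum>n. (cmod (taylor_coeff f n))\<^sup>2)"
  using H2_D(2)[OF assms] by (simp add: h2_norm_def suminf_nonneg)

lemma h2_norm_nonneg: "f \<in> H2 \<Longrightarrow> 0 \<le> h2_norm f"
  by (simp add: h2_norm_def suminf_nonneg H2_D(2))

lemma taylor_coeff_le_h2_norm:
  assumes "f \<in> H2"
  shows "cmod (taylor_coeff f n) \<le> h2_norm f"
proof (rule power2_le_imp_le)
  have "(\<Sum>k\<in>{n}. (cmod (taylor_coeff f k))\<^sup>2) \<le> (h2_norm f)\<^sup>2"
    unfolding h2_norm_sq[OF assms] by (intro sum_le_suminf H2_D assms) auto
  then show "(cmod (taylor_coeff f n))\<^sup>2 \<le> (h2_norm f)\<^sup>2" by simp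
qed (rule h2_norm_nonneg[OF assms])

lemma sum_taylor_coeff_le_h2_norm:
  assumes "f \<in> H2"
  shows "(\<Sum>k<n. (cmod (taylor_coeff f k))\<^sup>2) \<le> (h2_norm f)\<^sup>2"
  unfolding h2_norm_sq[OF assms] by (intro sum_le_suminf H2_D assms) auto

lemma H2_I:
  assumes "f holomorphic_on disk" "0 \<le> B" "\<And>N. (\<Sum>k<N. (cmod (taylor_coeff f k))\<^sup>2) \<le> B\<^sup>2"
  shows "f \<in> H2" "h2_norm f \<le> B"
proof -
  have s: "summable (\<lambda>n. (cmod (taylor_coeff f n))\<^sup>2)"
    by (rule summableI_nonneg_bounded[where x = "B\<^sup>2"]) (use assms in auto)
  then show "f \<in> H2"
    using assms(1) by (simp add: H2_def)
  then have "(h2_norm f)\<^sup>2 \<le> B\<^sup>2"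
    unfolding h2_norm_sq[OF \<open>f \<in> H2\<close>] using s assms(3) by (intro suminf_le_const)
  then show "h2_norm f \<le> B"
    using assms(2) power2_le_imp_le by blast
qed

text \<open>The parallelogram inequality, applied to each coefficient, takes the place of the
  triangle inequality. The factor 2 is harmless: later only membership and finiteness are drawn from
  it.\<close>

lemma H2_diff:
  assumes "f \<in> H2" "g \<in> H2"
  shows "(\<lambda>z. f z - g z) \<in> H2" "(h2_norm (\<lambda>z. f z - g z))\<^sup>2 \<le> 2 * (h2_norm f)\<^sup>2 + 2 * (h2_norm g)\<^sup>2"
proof -
  define B where "B = sqrt (2 * (h2_norm f)\<^sup>2 + 2 * (h2_norm g)\<^sup>2)"
  have B2: "B\<^sup>2 = 2 * (h2_norm f)\<^sup>2 + 2 * (h2_norm g)\<^sup>2" and "B \<ge> 0"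
    by (auto simp: B_def)
  have par: "(cmod (x - y))\<^sup>2 \<le> 2 * (cmod x)\<^sup>2 + 2 * (cmod y)\<^sup>2" for x y :: complex
  proof -
    have "0 \<le> (cmod (x + y))\<^sup>2" by simp
    then show ?thesis
      unfolding cmod_power2 by (simp add: power2_eq_square algebra_simps)
  qed
  have "(\<Sum>k<N. (cmod (taylor_coeff (\<lambda>z. f z - g z) k))\<^sup>2) \<le> B\<^sup>2" for N
  proof -
    have "(\<Sum>k<N. (cmod (taylor_coeff (\<lambda>z. f z - g z) k))\<^sup>2) \<le>
      (\<Sum>k<N. 2 * (cmod (taylor_coeff f k))\<^sup>2 + 2 * (cmod (taylor_coeff g k))\<^sup>2)"
      by (intro sum_mono) (use par in \<open>simp add: taylor_coeff_diff H2_D assms\<close>)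
    also have "\<dots> \<le> B\<^sup>2"
      using sum_taylor_coeff_le_h2_norm[OF assms(1), of N] sum_taylor_coeff_le_h2_norm[OF assms(2), of N]
      by (simp add: B2 sum.distrib flip: sum_distrib_left)
    finally show ?thesis .
  qed
  note * = H2_I[OF _ \<open>B \<ge> 0\<close> this]
  have hol: "(\<lambda>z. f z - g z) holomorphic_on disk"
    by (intro holomorphic_intros H2_D assms)
  show "(\<lambda>z. f z - g z) \<in> H2" by (rule *(1)[OF hol])
  then show "(h2_norm (\<lambda>z. f z - g z))\<^sup>2 \<le> 2 * (h2_norm f)\<^sup>2 + 2 * (h2_norm g)\<^sup>2"
    using *(2)[OF hol] h2_norm_nonneg unfolding B2[symmetric] by (intro power_mono) auto
qed

lemma zero_in_H2: "(\<lambda>z. 0) \<in> H2" and h2_norm_zero: "h2_norm (\<lambda>z. 0) = 0"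
proof -
  have "taylor_coeff (\<lambda>z. 0) n = 0" for n
    by (simp add: taylor_coeff_def)
  then show "(\<lambda>z. 0) \<in> H2" "h2_norm (\<lambda>z. 0) = 0"
    by (auto simp: H2_def h2_norm_def)
qed

section \<open>Dilations and their Taylor polynomials on the closed disk\<close>

lemma taylor_dilate_uniform:
  assumes "f holomorphic_on disk" "0 \<le> r" "r < 1"
  shows "uniform_limit (cball 0 1) (\<lambda>N z. \<Sum>j<N. (taylor_coeff f j * of_real r ^ j) * z ^ j)
           (\<lambda>z. f (of_real r * z)) sequentially"
proof -
  \<comment> \<open>Convergence at any point strictly between \<open>r\<close> and 1 gives absolute
    convergence at \<open>r\<close>.\<close>
  define s where "s = (1 + r) / 2"
  have s: "r < s" "s < 1" "0 < s" using assms by (auto simp: s_def)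
  have "summable (\<lambda>n. taylor_coeff f n * of_real s ^ n)"
    using taylor_sums[OF assms(1), of "of_real s"] s by (auto simp: sums_iff)
  then have sr: "summable (\<lambda>n. norm (taylor_coeff f n * of_real r ^ n))"
    by (rule powser_insidea) (use s assms in auto)
  have "uniform_limit (cball 0 1) (\<lambda>N z. \<Sum>j<N. (taylor_coeff f j * of_real r ^ j) * z ^ j)
      (\<lambda>z. \<Sum>j. (taylor_coeff f j * of_real r ^ j) * z ^ j) sequentially"
  proof (rule Weierstrass_m_test[OF _ sr])
    fix n and z :: complex assume "z \<in> cball 0 1"
    then have "cmod z ^ n \<le> 1" by (simp add: power_le_one)
    then show "norm (taylor_coeff f n * of_real r ^ n * z ^ n) \<le> norm (taylor_coeff f n * of_real r ^ n)"
      by (simp add: norm_mult norm_power mult_left_le)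
  qed
  moreover have "(\<Sum>j. (taylor_coeff f j * of_real r ^ j) * z ^ j) = f (of_real r * z)"
    if "z \<in> cball 0 1" for z
  proof -
    have "cmod (of_real r * z) < 1"
      using that assms mult_left_le[of "cmod z" r] by (simp add: norm_mult)
    then have "(\<lambda>n. taylor_coeff f n * (of_real r * z) ^ n) sums f (of_real r * z)"
      by (intro taylor_sums assms) auto
    then show ?thesis
      by (simp add: power_mult_distrib mult.assoc sums_iff)
  qed
  ultimately show ?thesis
    by (subst (asm) uniform_limit_cong'[where g = "\<lambda>N z. \<Sum>j<N. (taylor_coeff f j * of_real r ^ j) * z ^ j" and i = "\<lambda>z. f (of_real r * z)"]) auto
qed

lemma dilate_in_disk: "cmod z \<le> 1 \<Longrightarrow> 0 \<le> r \<Longrightarrow> r < 1 \<Longrightarrow> of_real r * z \<in> disk"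
  using mult_left_le[of "cmod z" r] by (simp add: norm_mult)

lemma taylor_dilate_norm_sq:
  assumes f: "f holomorphic_on disk" and r: "0 \<le> r" "r < 1" and e: "0 < e"
  shows "\<forall>\<^sub>F N in sequentially. \<forall>z\<in>cball 0 1.
     \<bar>(cmod (\<Sum>j<N. (taylor_coeff f j * of_real r ^ j) * z ^ j))\<^sup>2 - (cmod (f (of_real r * z)))\<^sup>2\<bar> < e"
proof -
  have "continuous_on (cball 0 1) (\<lambda>z. f (of_real r * z))"
    by (intro continuous_on_compose2[OF holomorphic_on_imp_continuous_on[OF f]] continuous_intros)
       (use dilate_in_disk r in auto)
  then have "bounded ((\<lambda>z. f (of_real r * z)) ` cball 0 1)"
    by (intro compact_imp_bounded compact_continuous_image) auto
  then obtain B where B: "0 < B" "\<And>z. z \<in> cball 0 1 \<Longrightarrow> cmod (f (of_real r * z)) \<le> B"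
    unfolding bounded_pos by blast
  \<comment> \<open>With \<open>d <= 1\<close> both moduli add up to at most
    \<open>2 * B + 1\<close>, and the squares then differ by at most
    \<open>d * (2 * B + 1) < e\<close>.\<close>
  define d where "d = min 1 (e / (2 * B + 2))"
  have d: "0 < d" "d \<le> 1" "d * (2 * B + 1) < e"
  proof -
    show "0 < d" "d \<le> 1" using B e by (auto simp: d_def)
    have "d * (2 * B + 1) \<le> e / (2 * B + 2) * (2 * B + 1)"
      using B by (intro mult_right_mono) (auto simp: d_def)
    also have "\<dots> < e" using B e by (simp add: field_simps)
    finally show "d * (2 * B + 1) < e" .
  qed
  have "\<forall>\<^sub>F N in sequentially. \<forall>z\<in>cball 0 1.
     dist (\<Sum>j<N. (taylor_coeff f j * of_real r ^ j) * z ^ j) (f (of_real r * z)) < d"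
    using taylor_dilate_uniform[OF f r] d(1) by (simp add: uniform_limit_iff)
  then show ?thesis
  proof (rule eventually_mono, intro ballI)
    fix N and z :: complex
    let ?x = "\<Sum>j<N. (taylor_coeff f j * of_real r ^ j) * z ^ j" and ?y = "f (of_real r * z)"
    assume *: "\<forall>z\<in>cball 0 1. dist (\<Sum>j<N. (taylor_coeff f j * of_real r ^ j) * z ^ j) (f (of_real r * z)) < d"
      and z: "z \<in> cball 0 1"
    have 1: "\<bar>cmod ?x - cmod ?y\<bar> < d"
      using * z norm_triangle_ineq3[of ?x ?y] by (force simp: dist_norm)
    have 2: "cmod ?x + cmod ?y \<le> 2 * B + 1"
      using 1 d(2) B(2)[OF z] by linarith
    have "\<bar>(cmod ?x)\<^sup>2 - (cmod ?y)\<^sup>2\<bar> = \<bar>cmod ?x - cmod ?y\<bar> * (cmod ?x + cmod ?y)"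
      by (simp add: square_diff_square_factored power2_eq_square abs_mult mult.commute)
    also have "\<dots> \<le> d * (2 * B + 1)"
      using 1 2 by (intro mult_mono) auto
    also note d(3)
    finally show "\<bar>(cmod ?x)\<^sup>2 - (cmod ?y)\<^sup>2\<bar> < e" .
  qed
qed

text \<open>The majorants below are sums over several functions with one common truncation degree,
  so a single \<open>N\<close> has to serve all \<open>n\<close> in \<open>A\<close>.\<close>

lemma taylor_dilate_norm_sq_sum:
  assumes f: "\<And>n. n \<in> A \<Longrightarrow> f n holomorphic_on disk" and r: "0 \<le> r" "r < 1" and e: "0 < e"
    and A: "finite A" and k: "\<And>n. n \<in> A \<Longrightarrow> 0 \<le> k n"
  shows "\<forall>\<^sub>F N in sequentially. \<forall>z\<in>cball 0 1.
     \<bar>(\<Sum>n\<in>A. k n * (cmod (\<Sum>j<N. (taylor_coeff (f n) j * of_real r ^ j) * z ^ j))\<^sup>2)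
      - (\<Sum>n\<in>A. k n * (cmod (f n (of_real r * z)))\<^sup>2)\<bar> \<le> e"
proof -
  define d where "d = e / (sum k A + 1)"
  have K: "0 \<le> sum k A" using k by (rule sum_nonneg)
  have d: "d > 0" using e K by (simp add: d_def)
  have "\<forall>\<^sub>F N in sequentially. \<forall>n\<in>A. \<forall>z\<in>cball 0 1.
     \<bar>(cmod (\<Sum>j<N. (taylor_coeff (f n) j * of_real r ^ j) * z ^ j))\<^sup>2 - (cmod (f n (of_real r * z)))\<^sup>2\<bar> < d"
    using A taylor_dilate_norm_sq[OF f r d] by (intro eventually_ball_finite) auto
  then show ?thesis
  proof (rule eventually_mono, intro ballI)
    fix N and z :: complex
    let ?x = "\<lambda>n. (cmod (\<Sum>j<N. (taylor_coeff (f n) j * of_real r ^ j) * z ^ j))\<^sup>2"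
    let ?y = "\<lambda>n. (cmod (f n (of_real r * z)))\<^sup>2"
    assume *: "\<forall>n\<in>A. \<forall>z\<in>cball 0 1.
     \<bar>(cmod (\<Sum>j<N. (taylor_coeff (f n) j * of_real r ^ j) * z ^ j))\<^sup>2 - (cmod (f n (of_real r * z)))\<^sup>2\<bar> < d"
      and z: "z \<in> cball 0 1"
    have "\<bar>(\<Sum>n\<in>A. k n * ?x n) - (\<Sum>n\<in>A. k n * ?y n)\<bar> = \<bar>\<Sum>n\<in>A. k n * (?x n - ?y n)\<bar>"
      by (simp add: right_diff_distrib sum_subtractf)
    also have "\<dots> \<le> (\<Sum>n\<in>A. k n * d)"
    proof (rule order_trans[OF sum_abs sum_mono])
      fix n assume n: "n \<in> A"
      then have "\<bar>?x n - ?y n\<bar> \<le> d" using * z by force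
      then show "\<bar>k n * (?x n - ?y n)\<bar> \<le> k n * d"
        using k[OF n] by (simp add: abs_mult mult_left_mono)
    qed
    also have "\<dots> = sum k A * d" by (simp add: sum_distrib_right)
    also have "\<dots> \<le> e" using e K by (simp add: d_def field_simps)
    finally show "\<bar>(\<Sum>n\<in>A. k n * ?x n) - (\<Sum>n\<in>A. k n * ?y n)\<bar> \<le> e" .
  qed
qed

text \<open>For fixed \<open>N\<close> the left side is a polynomial in \<open>r\<close>, so the
  bound passes to \<open>r = 1\<close> by continuity. Only \<open>r >= 1/2\<close> is asked for,
  because the energy estimate below needs \<open>r\<close> away from 0.\<close>

lemma sum_taylor_coeff_dilate_le:
  assumes "\<And>r. 1 / 2 \<le> r \<Longrightarrow> r < 1 \<Longrightarrow>
    (\<Sum>n\<in>A. k n * (\<Sum>j<N. (cmod (c n j * of_real r ^ j))\<^sup>2)) \<le> (B::real)"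
  shows "(\<Sum>n\<in>A. k n * (\<Sum>j<N. (cmod (c n j))\<^sup>2)) \<le> B"
proof -
  define h where "h = (\<lambda>r::real. \<Sum>n\<in>A. k n * (\<Sum>j<N. (cmod (c n j * of_real r ^ j))\<^sup>2))"
  have "isCont h 1"
    unfolding h_def by (intro continuous_intros)
  then have "(h \<longlongrightarrow> h 1) (at_left 1)"
    unfolding isCont_def by (rule tendsto_within_subset) auto
  moreover have "\<forall>\<^sub>F r in at_left 1. h r \<le> B"
    using eventually_at_left[of "1/2" "1::real"] assms unfolding h_def
    by (auto intro!: exI[of _ "1/2"])
  ultimately have "h 1 \<le> B"
    by (rule tendsto_upperbound) auto
  then show ?thesis by (simp add: h_def)
qed

text \<open>The majorant of a Taylor polynomial of a dilation has real part at most
  \<open>B^2 + e\<close> on the circle, hence also at 0, where its value is the sum of squared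
  coefficients. Then \<open>r\<close> tends to 1 and \<open>e\<close> to 0.\<close>

lemma bounded_in_H2:
  assumes f: "f holomorphic_on disk" and B: "0 \<le> B" "\<And>z. z \<in> disk \<Longrightarrow> cmod (f z) \<le> B"
  shows "f \<in> H2" "h2_norm f \<le> B"
proof -
  have 1: "(\<Sum>j<N. (cmod (taylor_coeff f j * of_real r ^ j))\<^sup>2) \<le> B\<^sup>2 + e"
    if r: "1 / 2 \<le> r" "r < 1" and e: "0 < e" for N r e
  proof -
    define c where "c = (\<lambda>j. taylor_coeff f j * of_real r ^ j)"
    obtain N' where N': "N' \<ge> N" and
      N'2: "\<And>z. z \<in> cball 0 1 \<Longrightarrow> \<bar>(cmod (\<Sum>j<N'. c j * z ^ j))\<^sup>2 - (cmod (f (of_real r * z)))\<^sup>2\<bar> < e"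
      using eventually_conj[OF eventually_ge_at_top[of N] taylor_dilate_norm_sq[OF f _ r(2) e]] r
      unfolding c_def eventually_sequentially by force
    have "Re (majorant_poly c N' 0) \<le> B\<^sup>2 + e"
    proof (rule Re_le_of_circle[where f = "majorant_poly c N'"])
      fix z :: complex assume z: "cmod z = 1"
      have "cmod (f (of_real r * z)) \<le> B"
        using z r by (intro B(2) dilate_in_disk) auto
      then have "(cmod (f (of_real r * z)))\<^sup>2 \<le> B\<^sup>2"
        by (intro power_mono) auto
      then show "Re (majorant_poly c N' z) \<le> B\<^sup>2 + e"
        using N'2[of z] z by (auto simp: Re_majorant_poly_circle)
    qed (auto intro: holomorphic_intros)
    moreover have "(\<Sum>j<N. (cmod (c j))\<^sup>2) \<le> (\<Sum>j<N'. (cmod (c j))\<^sup>2)"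
      using N' by (intro sum_mono2) auto
    ultimately show ?thesis
      by (simp add: majorant_poly_0 c_def)
  qed
  have "(\<Sum>j<N. (cmod (taylor_coeff f j))\<^sup>2) \<le> B\<^sup>2" for N
  proof (rule field_le_epsilon)
    fix e :: real assume "0 < e"
    then show "(\<Sum>j<N. (cmod (taylor_coeff f j))\<^sup>2) \<le> B\<^sup>2 + e"
      using sum_taylor_coeff_dilate_le[where A = "{0::nat}" and k = "\<lambda>_. 1" and N = N
        and c = "\<lambda>_. taylor_coeff f" and B = "B\<^sup>2 + e"] 1 by auto
  qed
  from H2_I[OF f B(1) this] show "f \<in> H2" "h2_norm f \<le> B" .
qed

section \<open>Logarithmic integrability\<close>

text \<open>The energy estimate evaluates at the origin, where the weight may vanish. Dividing out
  the zero changes the modulus on the circle of radius \<open>r\<close> only by the factor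
  \<open>r ^ k\<close>.\<close>

lemma holomorphic_factor_zero_disk:
  assumes f: "f holomorphic_on disk" and nz: "\<exists>z\<in>disk. f z \<noteq> 0"
  obtains k g where "g holomorphic_on disk" "g 0 \<noteq> 0" "\<And>z. z \<in> disk \<Longrightarrow> f z = z ^ k * g z"
proof -
  define c where "c = taylor_coeff f"
  have "\<exists>k. c k \<noteq> 0"
  proof (rule ccontr)
    assume "\<not> ?thesis"
    then have "f z = 0" if "z \<in> disk" for z
      using taylor_sums[OF f that] by (simp add: c_def sums_iff)
    with nz show False by auto
  qed
  define k where "k = (LEAST k. c k \<noteq> 0)"
  have ck: "c k \<noteq> 0" and below: "\<And>i. i < k \<Longrightarrow> c i = 0"
    unfolding k_def using LeastI_ex[OF \<open>\<exists>k. c k \<noteq> 0\<close>] by (auto dest: not_less_Least)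
  define g where "g = (\<lambda>z. \<Sum>n. c (n + k) * z ^ n)"
  have shift: "(\<lambda>n. c (n + k) * z ^ (n + k)) sums f z" if "z \<in> disk" for z
    using sums_split_initial_segment[OF taylor_sums[OF f that], of k] below by (simp add: c_def)
  have g: "(\<lambda>n. c (n + k) * z ^ n) sums g z" if "z \<in> disk" for z
  proof (cases "z = 0")
    case True
    then show ?thesis
      unfolding g_def using powser_sums_zero[of "\<lambda>n. c (n + k)"] by (simp add: sums_iff)
  next
    case False
    then have "(\<lambda>n. c (n + k) * z ^ n) sums (f z / z ^ k)"
      using sums_divide[OF shift[OF that], of "z ^ k"] by (simp add: power_add)
    then show ?thesis by (simp add: g_def sums_iff)
  qed
  show ?thesis
  proof
    show "g holomorphic_on disk"
      by (rule power_series_holomorphic[where a = "\<lambda>n. c (n + k)"]) (use g in auto)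
    show "g 0 \<noteq> 0"
      using ck powser_sums_zero[of "\<lambda>n. c (n + k)"] by (simp add: g_def sums_iff)
    show "f z = z ^ k * g z" if "z \<in> disk" for z
    proof -
      have "(\<lambda>n. z ^ k * (c (n + k) * z ^ n)) sums (z ^ k * g z)"
        by (intro sums_mult g that)
      also have "(\<lambda>n. z ^ k * (c (n + k) * z ^ n)) = (\<lambda>n. c (n + k) * z ^ (n + k))"
        by (simp add: power_add mult_ac)
      finally show ?thesis
        using sums_unique2[OF shift[OF that]] by simp
    qed
  qed
qed

text \<open>The term at \<open>n = 0\<close> is \<open>1 / 0 = 0\<close>, so the series effectively
  starts at 1. The same convention applies to every sum over \<open>1 / real n\<close>
  below.\<close>

lemma neg_ln_sums:
  fixes x :: real
  assumes "0 \<le> x" "x < 1"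
  shows "(\<lambda>n. x ^ n / real n) sums (- ln (1 - x))"
  using sums_minus[OF ln_series'[of "-x"]] assms by simp

text \<open>Classical choice: one over the square root of the tail of the series. It tends to
  infinity, and the weighted terms are dominated by a telescoping series.\<close>

lemma diverging_weights_exist:
  fixes b :: "nat \<Rightarrow> real"
  assumes b: "\<And>n. 0 \<le> b n" "summable b"
  obtains a where "\<And>n. 0 \<le> a n" "filterlim a at_top sequentially" "summable (\<lambda>n. a n * b n)"
proof -
  \<comment> \<open>The added geometric term makes every tail strictly positive, so that its inverse
    square root makes sense.\<close>
  define b' where "b' = (\<lambda>n. b n + (1/2) ^ n)"
  have b': "0 < b' n" "b n \<le> b' n" for n
    using b(1) by (auto simp: b'_def add_nonneg_pos)
  have sb': "summable b'"
    unfolding b'_def by (intro summable_add b summable_geometric) auto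
  define t where "t = (\<lambda>n. suminf b' - (\<Sum>i<n. b' i))"
  have t_pos: "0 < t n" for n
    using sum_less_suminf[OF sb', of n] b' by (simp add: t_def)
  have t_Suc: "t n - t (Suc n) = b' n" for n
    by (simp add: t_def)
  have "t \<longlonglongrightarrow> suminf b' - suminf b'"
    unfolding t_def by (intro tendsto_intros summable_LIMSEQ sb')
  then have t0: "t \<longlonglongrightarrow> 0" by simp
  define a where "a = (\<lambda>n. 1 / sqrt (t n))"
  have sq0: "(\<lambda>n. sqrt (t n)) \<longlonglongrightarrow> 0"
    using tendsto_real_sqrt[OF t0] by simp
  show ?thesis
  proof
    show a_nn: "0 \<le> a n" for n
      using t_pos[of n] by (simp add: a_def)
    have "filterlim (\<lambda>n. inverse (sqrt (t n))) at_top sequentially"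
      using sq0 t_pos by (intro filterlim_inverse_at_top) auto
    then show "filterlim a at_top sequentially"
      by (simp add: a_def inverse_eq_divide)
    have "summable (\<lambda>n. 2 * (sqrt (t n) - sqrt (t (Suc n))))"
      by (intro summable_mult telescope_summable'[OF sq0])
    then show "summable (\<lambda>n. a n * b n)"
    proof (rule summable_comparison_test')
      fix n
      let ?x = "sqrt (t n)" and ?y = "sqrt (t (Suc n))"
      have xy: "0 < ?x" "0 < ?y" "?y \<le> ?x"
        using t_pos t_Suc[of n] b'(1)[of n] by auto
      \<comment> \<open>A difference of tails is a difference of squares of \<open>?x\<close> and
        \<open>?y\<close>; dividing by \<open>?x\<close> leaves a factor
        \<open>(?x + ?y) / ?x\<close>, which is at most 2.\<close>
      have "b' n = (?x - ?y) * (?x + ?y)"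
        using t_Suc[of n] t_pos[of n] t_pos[of "Suc n"] by (simp add: algebra_simps)
      then have "a n * b' n = (?x - ?y) * ((?x + ?y) / ?x)"
        by (simp add: a_def)
      also have "\<dots> \<le> (?x - ?y) * 2"
        using xy by (intro mult_left_mono) (auto simp: field_simps)
      finally have "a n * b' n \<le> 2 * (?x - ?y)" by simp
      moreover have "a n * b n \<le> a n * b' n"
        using a_nn b' by (intro mult_left_mono) auto
      ultimately show "norm (a n * b n) \<le> 2 * (?x - ?y)"
        using a_nn b by (simp add: abs_mult)
    qed
  qed
qed

lemma power_self_map_in_H2:
  assumes "\<phi> holomorphic_on disk" "\<phi> ` disk \<subseteq> disk"
  shows "(\<lambda>z. \<phi> z ^ n) \<in> H2"
proof (rule bounded_in_H2)
  show "(\<lambda>z. \<phi> z ^ n) holomorphic_on disk"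
    by (intro holomorphic_intros assms)
  fix z :: complex assume "z \<in> disk"
  then have "cmod (\<phi> z) < 1" using assms(2) by force
  then show "cmod (\<phi> z ^ n) \<le> 1"
    by (simp add: norm_power power_le_one)
qed simp

text \<open>On the unit circle \<open>exp (Re F)\<close> and \<open>Re H\<close> are comparable to \<open>1 / (1 - |\<phi>|\<^sup>2)\<close> and
  \<open>|w|\<^sup>2 / (1 - |\<phi>|\<^sup>2)\<close> at the dilated point, so \<open>w\<^sup>2 exp F / (H + 1)\<close>
  is bounded there; its value at the origin controls \<open>F 0\<close>.\<close>
lemma log_energy_dilate_bound:
  fixes \<phi> w g :: "complex \<Rightarrow> complex"
  assumes \<phi>: "\<phi> holomorphic_on disk" "\<phi> ` disk \<subseteq> disk"
    and H2: "\<And>n. (\<lambda>z. w z * \<phi> z ^ n) \<in> H2"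
    and sm: "summable (\<lambda>n. (h2_norm (\<lambda>z. w z * \<phi> z ^ n))\<^sup>2)"
    and g: "g holomorphic_on disk" "g 0 \<noteq> 0" and wg: "\<And>z. z \<in> disk \<Longrightarrow> w z = z ^ k * g z"
    and r: "1 / 2 \<le> r" "r < 1"
  shows "(\<Sum>n<M. 1 / real n * (\<Sum>j<N0. (cmod (taylor_coeff (\<lambda>z. \<phi> z ^ n) j * of_real r ^ j))\<^sup>2))
      \<le> ln (2 * exp 1 * ((\<Sum>n. (h2_norm (\<lambda>z. w z * \<phi> z ^ n))\<^sup>2) + 1) / (((1/2) ^ k * cmod (g 0))\<^sup>2))"
proof -
  define S where "S = (\<Sum>n. (h2_norm (\<lambda>z. w z * \<phi> z ^ n))\<^sup>2)"
  have r0: "0 \<le> r" using r by simp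
  have w: "w holomorphic_on disk" using H2_D(1)[OF H2[of 0]] by simp
  have hol: "(\<lambda>z. \<phi> z ^ n) holomorphic_on disk" "(\<lambda>z. w z * \<phi> z ^ n) holomorphic_on disk" for n
    by (auto intro!: holomorphic_intros \<phi> w)
  have dil: "of_real r * z \<in> disk" if "cmod z \<le> 1" for z
    using that r by (intro dilate_in_disk) auto
  \<comment> \<open>The closed disk of radius \<open>r\<close> is compact, so \<phi> maps it into a
    smaller disk, of radius \<open>q < 1\<close>.\<close>
  obtain q where q: "0 \<le> q" "q < 1" "\<And>z. cmod z \<le> 1 \<Longrightarrow> cmod (\<phi> (of_real r * z)) \<le> q"
  proof -
    have "continuous_on (cball 0 1) (\<lambda>z. cmod (\<phi> (of_real r * z)))"
      by (intro continuous_on_norm continuous_on_compose2[OF holomorphic_on_imp_continuous_on[OF \<phi>(1)]]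
            continuous_intros) (use dil in auto)
    then obtain x where "x \<in> cball 0 1"
      "\<And>y. y \<in> cball 0 1 \<Longrightarrow> cmod (\<phi> (of_real r * y)) \<le> cmod (\<phi> (of_real r * x))"
      using continuous_attains_sup[of "cball 0 1" "\<lambda>z. cmod (\<phi> (of_real r * z))"] by auto
    moreover from this have "cmod (\<phi> (of_real r * x)) < 1"
      using \<phi>(2) dil[of x] by force
    ultimately show ?thesis
      using that[of "cmod (\<phi> (of_real r * x))"] by auto
  qed
  have "q\<^sup>2 < 1" using q by (simp add: abs_square_less_1)
  \<comment> \<open>With this \<open>M'\<close> the partial geometric sum is at least half of
    \<open>1 / (1 - x)\<close>, for all \<open>x\<close> in \<open>[0, q^2]\<close> at once.\<close>
  then obtain M' where M': "(q\<^sup>2) ^ M' < 1/2"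
    using real_arch_pow_inv[of "1/2" "q\<^sup>2"] by auto
  define cp where "cp = (\<lambda>n j. taylor_coeff (\<lambda>z. \<phi> z ^ n) j * of_real r ^ j)"
  define cw where "cw = (\<lambda>n j. taylor_coeff (\<lambda>z. w z * \<phi> z ^ n) j * of_real r ^ j)"
  have "\<forall>\<^sub>F N in sequentially. N0 \<le> N \<and>
     (\<forall>z\<in>cball 0 1. \<bar>(\<Sum>n<M. 1 / real n * (cmod (\<Sum>j<N. cp n j * z ^ j))\<^sup>2)
      - (\<Sum>n<M. 1 / real n * (cmod (\<phi> (of_real r * z) ^ n))\<^sup>2)\<bar> \<le> 1) \<and>
     (\<forall>z\<in>cball 0 1. \<bar>(\<Sum>n<M'. 1 * (cmod (\<Sum>j<N. cw n j * z ^ j))\<^sup>2)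
      - (\<Sum>n<M'. 1 * (cmod (w (of_real r * z) * \<phi> (of_real r * z) ^ n))\<^sup>2)\<bar> \<le> 1)"
    unfolding cp_def cw_def
    by (intro eventually_conj eventually_ge_at_top taylor_dilate_norm_sq_sum hol r r0) auto
  then obtain N where N: "N0 \<le> N"
    "\<And>z. cmod z \<le> 1 \<Longrightarrow> \<bar>(\<Sum>n<M. 1 / real n * (cmod (\<Sum>j<N. cp n j * z ^ j))\<^sup>2)
      - (\<Sum>n<M. 1 / real n * (cmod (\<phi> (of_real r * z) ^ n))\<^sup>2)\<bar> \<le> 1"
    "\<And>z. cmod z \<le> 1 \<Longrightarrow> \<bar>(\<Sum>n<M'. (cmod (\<Sum>j<N. cw n j * z ^ j))\<^sup>2)
      - (\<Sum>n<M'. (cmod (w (of_real r * z) * \<phi> (of_real r * z) ^ n))\<^sup>2)\<bar> \<le> 1"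
    unfolding eventually_sequentially by (auto simp del: power_mult_distrib)
  \<comment> \<open>On the circle, up to an error of 1, \<open>Re (F z)\<close> is a partial sum of
    \<open>- ln (1 - x)\<close> and \<open>Re (H z)\<close> is the squared modulus of the weight
    times a partial geometric sum, where \<open>x\<close> is the squared modulus of \<phi> at the
    dilated point.\<close>
  define F where "F = (\<lambda>z. \<Sum>n<M. of_real (1 / real n) * majorant_poly (cp n) N z)"
  define H where "H = (\<lambda>z. \<Sum>n<M'. majorant_poly (cw n) N z)"
  have H_nonneg: "0 \<le> Re (H z)" if "cmod z \<le> 1" for z
    unfolding H_def Re_sum using Re_majorant_poly_ge[OF that] by (intro sum_nonneg) (meson order_trans zero_le_power2)
  \<comment> \<open>The summand 1 keeps the denominator of \<open>G\<close> away from zero and also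
    absorbs the approximation error in \<open>H\<close>.\<close>
  have H1: "H z + 1 \<noteq> 0" if "cmod z \<le> 1" for z
    using H_nonneg[OF that] by (auto simp: complex_eq_iff)
  \<comment> \<open>The factor \<open>r ^ k * g\<close> has the modulus of \<open>w\<close> at the
    dilated point when \<open>z\<close> is on the circle, but does not vanish at the origin.\<close>
  define G where "G = (\<lambda>z. (of_real r ^ k * g (of_real r * z))\<^sup>2 * exp (F z) / (H z + 1))"
  have G_hol: "G holomorphic_on ball 0 1" and G_cont: "continuous_on (cball 0 1) G"
  proof -
    have FH: "F holomorphic_on A" "H holomorphic_on A" for A
      unfolding F_def H_def by (intro holomorphic_intros)+
    have gr: "(\<lambda>z. g (of_real r * z)) holomorphic_on ball 0 1"
    proof -
      have "(\<lambda>z. of_real r * z) ` ball 0 1 \<subseteq> disk" using dil by auto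
      then show ?thesis
        using holomorphic_on_compose_gen[OF _ g(1), of "\<lambda>z. of_real r * z" "ball 0 1"]
        by (auto simp: o_def intro!: holomorphic_intros)
    qed
    show "G holomorphic_on ball 0 1"
      unfolding G_def by (intro holomorphic_intros FH gr H1) auto
    show "continuous_on (cball 0 1) G"
      unfolding G_def
      by (intro continuous_intros holomorphic_on_imp_continuous_on[OF FH(1)]
          holomorphic_on_imp_continuous_on[OF FH(2)]
          continuous_on_compose2[OF holomorphic_on_imp_continuous_on[OF g(1)]])
         (use H1 dil in auto)
  qed
  have G_le: "cmod (G z) \<le> 2 * exp 1" if z: "cmod z = 1" for z
  proof -
    define u where "u = of_real r * z"
    define x where "x = (cmod (\<phi> u))\<^sup>2"
    have u: "u \<in> disk" using dil z by (simp add: u_def)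
    have x: "0 \<le> x" "x \<le> q\<^sup>2" "x < 1"
      using q(3)[of z] z \<open>q\<^sup>2 < 1\<close> power_mono[of "cmod (\<phi> u)" q 2] unfolding x_def u_def by auto
    have "Re (F z) \<le> 1 + (\<Sum>n<M. 1 / real n * (cmod (\<phi> u ^ n))\<^sup>2)"
      using N(2)[of z] z by (simp add: F_def Re_majorant_poly_circle u_def)
    also have "(\<Sum>n<M. 1 / real n * (cmod (\<phi> u ^ n))\<^sup>2) = (\<Sum>n<M. x ^ n / real n)"
      by (simp add: x_def norm_power power_commutes flip: power_mult)
         (simp add: mult.commute)
    also have "\<dots> \<le> - ln (1 - x)"
      using neg_ln_sums[OF x(1,3)] x(1) unfolding sums_iff
      by (auto intro!: sum_le_suminf elim!: ssubst[OF sym])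
    finally have "exp (Re (F z)) \<le> exp (1 - ln (1 - x))" by simp
    also have "\<dots> = exp 1 / (1 - x)" using x by (simp add: exp_diff)
    finally have eF: "exp (Re (F z)) \<le> exp 1 / (1 - x)" .
    have geo: "1 / (1 - x) \<le> 2 * (\<Sum>n<M'. x ^ n)"
    proof -
      have "x ^ M' \<le> 1/2" using power_mono[OF x(2,1), of M'] M' by linarith
      moreover have "(\<Sum>n<M'. x ^ n) = (1 - x ^ M') / (1 - x)"
        using x by (simp add: sum_gp_strict)
      ultimately show ?thesis using x by (simp add: divide_right_mono)
    qed
    have "(cmod (w u))\<^sup>2 * (1 / (1 - x)) \<le> (cmod (w u))\<^sup>2 * (2 * (\<Sum>n<M'. x ^ n))"
      by (intro mult_left_mono geo) auto
    also have "\<dots> = 2 * (\<Sum>n<M'. (cmod (w u * \<phi> u ^ n))\<^sup>2)"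
      by (simp add: x_def norm_mult norm_power power_mult_distrib sum_distrib_left mult_ac flip: power_mult)
    also have "\<dots> \<le> 2 * (Re (H z) + 1)"
      using N(3)[of z] z by (simp add: H_def Re_majorant_poly_circle u_def)
    finally have wH: "(cmod (w u))\<^sup>2 * (1 / (1 - x)) \<le> 2 * (Re (H z) + 1)" .
    have "cmod (of_real r ^ k * g u) = cmod (w u)"
      using wg[OF u] z by (simp add: u_def norm_mult norm_power)
    then have "cmod (G z) = (cmod (w u))\<^sup>2 * exp (Re (F z)) / cmod (H z + 1)"
      unfolding G_def u_def[symmetric] by (simp add: norm_divide norm_mult norm_power)
    also have "\<dots> \<le> (cmod (w u))\<^sup>2 * (exp 1 / (1 - x)) / cmod (H z + 1)"
      by (intro divide_right_mono mult_left_mono eF) auto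
    also have "\<dots> = exp 1 * ((cmod (w u))\<^sup>2 * (1 / (1 - x))) / cmod (H z + 1)"
      by simp
    also have "\<dots> \<le> exp 1 * (2 * (Re (H z) + 1)) / cmod (H z + 1)"
      by (intro divide_right_mono mult_left_mono wH) auto
    also have "\<dots> \<le> 2 * exp 1"
    proof -
      have "Re (H z) + 1 \<le> cmod (H z + 1)"
        using complex_Re_le_cmod[of "H z + 1"] by simp
      then show ?thesis using H1[of z] z by (simp add: divide_le_eq)
    qed
    finally show ?thesis .
  qed
  have G0_le: "cmod (G 0) \<le> 2 * exp 1"
    by (rule maximum_modulus_frontier[of G "cball 0 1"])
       (use G_hol G_cont G_le in auto)
  define f0 where "f0 = (\<Sum>n<M. 1 / real n * (\<Sum>j<N. (cmod (cp n j))\<^sup>2))"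
  define h0 where "h0 = (\<Sum>n<M'. \<Sum>j<N. (cmod (cw n j))\<^sup>2)"
  have F0: "F 0 = of_real f0" and H0: "H 0 = of_real h0"
    by (simp_all add: F_def H_def f0_def h0_def majorant_poly_0)
  have h0: "0 \<le> h0" "h0 \<le> S"
  proof -
    show "0 \<le> h0" unfolding h0_def by (intro sum_nonneg) auto
    have "h0 \<le> (\<Sum>n<M'. (h2_norm (\<lambda>z. w z * \<phi> z ^ n))\<^sup>2)"
      unfolding h0_def
    proof (rule sum_mono)
      fix n
      have "cmod (cw n j) \<le> cmod (taylor_coeff (\<lambda>z. w z * \<phi> z ^ n) j)" for j
        using r by (simp add: cw_def norm_mult norm_power mult_left_le power_le_one)
      then have "(\<Sum>j<N. (cmod (cw n j))\<^sup>2) \<le> (\<Sum>j<N. (cmod (taylor_coeff (\<lambda>z. w z * \<phi> z ^ n) j))\<^sup>2)"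
        by (intro sum_mono power_mono) auto
      also note sum_taylor_coeff_le_h2_norm[OF H2]
      finally show "(\<Sum>j<N. (cmod (cw n j))\<^sup>2) \<le> (h2_norm (\<lambda>z. w z * \<phi> z ^ n))\<^sup>2" .
    qed
    also have "\<dots> \<le> S" unfolding S_def using sm by (intro sum_le_suminf) auto
    finally show "h0 \<le> S" .
  qed
  \<comment> \<open>Replacing \<open>r ^ k\<close> by \<open>(1/2) ^ k\<close> makes the final bound
    independent of \<open>r\<close>.\<close>
  let ?c = "((1/2) ^ k * cmod (g 0))\<^sup>2"
  have c: "?c > 0" using g(2) by simp
  have "?c * exp f0 \<le> (r ^ k * cmod (g 0))\<^sup>2 * exp f0"
    using r by (intro mult_right_mono power_mono) auto
  also have "\<dots> = cmod (G 0) * (h0 + 1)"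
  proof -
    have "cmod (of_real h0 + 1) = h0 + 1"
      using h0 by (metis norm_of_real abs_of_nonneg of_real_1 of_real_add add_nonneg_nonneg zero_le_one)
    then show ?thesis
      using h0 r0 by (simp add: G_def F0 H0 norm_divide norm_mult norm_power)
  qed
  also have "\<dots> \<le> 2 * exp 1 * (S + 1)"
    using h0 by (intro mult_mono G0_le) auto
  finally have "exp f0 \<le> 2 * exp 1 * (S + 1) / ?c"
    using c by (simp add: pos_le_divide_eq mult.commute)
  then have "f0 \<le> ln (2 * exp 1 * (S + 1) / ?c)"
    by (metis exp_gt_zero ln_exp ln_le_cancel_iff order_less_le_trans)
  moreover have "(\<Sum>n<M. 1 / real n * (\<Sum>j<N0. (cmod (cp n j))\<^sup>2)) \<le> f0"
    unfolding f0_def using N(1) by (intro sum_mono mult_left_mono sum_mono2) auto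
  ultimately show ?thesis
    unfolding cp_def S_def by linarith
qed

text \<open>The preceding bound depends neither on \<open>r\<close> nor on the two truncations. So
  \<open>r\<close> goes to 1 first, then the number of coefficients to infinity, and bounded partial
  sums of nonnegative terms remain.\<close>

lemma log_energy_summable:
  assumes \<phi>: "\<phi> holomorphic_on disk" "\<phi> ` disk \<subseteq> disk"
    and nz: "\<exists>z\<in>disk. w z \<noteq> 0"
    and H2: "\<And>n. (\<lambda>z. w z * \<phi> z ^ n) \<in> H2"
    and sm: "summable (\<lambda>n. (h2_norm (\<lambda>z. w z * \<phi> z ^ n))\<^sup>2)"
  shows "summable (\<lambda>n. (h2_norm (\<lambda>z. \<phi> z ^ n))\<^sup>2 / real n)"
proof -
  have w: "w holomorphic_on disk" using H2_D(1)[OF H2[of 0]] by simp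
  obtain k g where g: "g holomorphic_on disk" "g 0 \<noteq> 0" and wg: "\<And>z. z \<in> disk \<Longrightarrow> w z = z ^ k * g z"
    using holomorphic_factor_zero_disk[OF w nz] by metis
  define B where "B = ln (2 * exp 1 * ((\<Sum>n. (h2_norm (\<lambda>z. w z * \<phi> z ^ n))\<^sup>2) + 1) / (((1/2) ^ k * cmod (g 0))\<^sup>2))"
  have le: "(\<Sum>n<M. 1 / real n * (\<Sum>j<N. (cmod (taylor_coeff (\<lambda>z. \<phi> z ^ n) j))\<^sup>2)) \<le> B" for M N
    by (rule sum_taylor_coeff_dilate_le)
       (use log_energy_dilate_bound[OF \<phi> H2 sm g wg] in \<open>simp add: B_def\<close>)
  have "(\<Sum>n<M. (h2_norm (\<lambda>z. \<phi> z ^ n))\<^sup>2 / real n) \<le> B" for M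
  proof (rule LIMSEQ_le_const2)
    have "(\<lambda>N. \<Sum>j<N. (cmod (taylor_coeff (\<lambda>z. \<phi> z ^ n) j))\<^sup>2) \<longlonglongrightarrow> (h2_norm (\<lambda>z. \<phi> z ^ n))\<^sup>2" for n
      using H2_D(2)[OF power_self_map_in_H2[OF \<phi>]] unfolding h2_norm_sq[OF power_self_map_in_H2[OF \<phi>]]
      by (rule summable_LIMSEQ)
    then have "(\<lambda>N. \<Sum>n<M. 1 / real n * (\<Sum>j<N. (cmod (taylor_coeff (\<lambda>z. \<phi> z ^ n) j))\<^sup>2))
      \<longlonglongrightarrow> (\<Sum>n<M. 1 / real n * (h2_norm (\<lambda>z. \<phi> z ^ n))\<^sup>2)"
      by (intro tendsto_intros)
    then show "(\<lambda>N. \<Sum>n<M. 1 / real n * (\<Sum>j<N. (cmod (taylor_coeff (\<lambda>z. \<phi> z ^ n) j))\<^sup>2))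
      \<longlonglongrightarrow> (\<Sum>n<M. (h2_norm (\<lambda>z. \<phi> z ^ n))\<^sup>2 / real n)" by simp
  qed (use le in auto)
  then show ?thesis
    by (intro summableI_nonneg_bounded[where x = B]) auto
qed

section \<open>The weight\<close>

text \<open>From some index \<open>m\<close> on the weights are at least \<open>L\<close>, so the
  sum in the exponent is at least \<open>- L * ln (1 - x)\<close> up to a constant. Partial sums are
  used because the full series need not converge under these hypotheses.\<close>

lemma log_weight_superpolynomial:
  fixes a :: "nat \<Rightarrow> real"
  assumes a: "\<And>n. 0 \<le> a n" "filterlim a at_top sequentially"
  obtains C where "0 < C"
    "\<And>x u. 0 \<le> x \<Longrightarrow> x < 1 \<Longrightarrow> (\<And>M. u \<le> exp (- (\<Sum>n<M. a n / real n * x ^ n))) \<Longrightarrow> u \<le> C * (1 - x) ^ L"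
proof -
  obtain m where m: "\<And>n. m \<le> n \<Longrightarrow> real L \<le> a n"
    using a(2) unfolding filterlim_at_top eventually_sequentially by metis
  \<comment> \<open>Each of the first \<open>m\<close> terms \<open>x ^ n / real n\<close> is at
    most 1, so ignoring them costs at most \<open>L * m\<close> in the exponent.\<close>
  show ?thesis
  proof (rule that[of "exp (real L * real m)"])
    fix x u :: real
    assume x: "0 \<le> x" "x < 1" and u: "\<And>M. u \<le> exp (- (\<Sum>n<M. a n / real n * x ^ n))"
    have *: "real L * (\<Sum>n<M. x ^ n / real n) - real L * real m \<le> (\<Sum>n<M. a n / real n * x ^ n)" for M
    proof -
      have le1: "x ^ n / real n \<le> 1" for n
        using x power_le_one[of x n] by (cases "n = 0") (auto simp: divide_le_eq)
      have "real L * (\<Sum>n<M. x ^ n / real n) \<le>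
          (\<Sum>n<M. a n / real n * x ^ n + real L * (if n < m then 1 else 0))"
        unfolding sum_distrib_left
      proof (rule sum_mono)
        fix n
        show "real L * (x ^ n / real n) \<le> a n / real n * x ^ n + real L * (if n < m then 1 else 0)"
        proof (cases "n < m")
          case True
          have "real L * (x ^ n / real n) \<le> real L * 1"
            by (intro mult_left_mono le1) auto
          then show ?thesis using True a(1)[of n] x by (simp add: add_increasing)
        next
          case False
          then have "real L * (x ^ n / real n) \<le> a n * (x ^ n / real n)"
            using m x by (intro mult_right_mono) auto
          then show ?thesis using False by simp
        qed
      qed
      also have "\<dots> = (\<Sum>n<M. a n / real n * x ^ n) + real L * (\<Sum>n<M. if n < m then 1 else 0)"
        by (simp add: sum.distrib sum_distrib_left)
      also have "(\<Sum>n<M. if n < m then 1 else 0) = real (card ({..<M} \<inter> {n. n < m}))"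
        by (simp add: sum.If_cases)
      also have "real (card ({..<M} \<inter> {n. n < m})) \<le> real m"
        using card_mono[of "{..<m}" "{..<M} \<inter> {n. n < m}"] by auto
      finally show ?thesis by (simp add: mult_left_mono)
    qed
    have "u \<le> exp (real L * real m - real L * (\<Sum>n<M. x ^ n / real n))" for M
      using u[of M] *[of M] by (smt (verit) exp_le_cancel_iff)
    moreover have "(\<lambda>M. exp (real L * real m - real L * (\<Sum>n<M. x ^ n / real n)))
        \<longlonglongrightarrow> exp (real L * real m - real L * (- ln (1 - x)))"
      using neg_ln_sums[OF x] unfolding sums_def by (intro tendsto_intros)
    ultimately have "u \<le> exp (real L * real m - real L * (- ln (1 - x)))"
      by (intro LIMSEQ_le_const) auto
    also have "\<dots> = exp (real L * real m) * (1 - x) ^ L"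
      using x by (simp add: exp_add exp_of_nat_mult)
    finally show "u \<le> exp (real L * real m) * (1 - x) ^ L" .
  qed simp
qed

text \<open>The weight is a limit of exponentials of finite sums of majorants, taken by Montel's
  theorem, so convergence of the exponents themselves need not be proved. The lower bound
  \<open>exp (- A)\<close> at the origin keeps the limit from vanishing there.\<close>

lemma rapidly_decaying_weight:
  assumes \<phi>: "\<phi> holomorphic_on disk" "\<phi> ` disk \<subseteq> disk"
    and sm: "summable (\<lambda>n. (h2_norm (\<lambda>z. \<phi> z ^ n))\<^sup>2 / real n)"
  obtains w where "w holomorphic_on disk" "w 0 \<noteq> 0"
    "\<And>L. \<exists>C>0. \<forall>z\<in>disk. cmod (w z) \<le> C * (1 - (cmod (\<phi> z))\<^sup>2) ^ L"
proof -
  obtain a where a: "\<And>n. 0 \<le> a n" "filterlim a at_top sequentially"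
    and sa: "summable (\<lambda>n. a n * ((h2_norm (\<lambda>z. \<phi> z ^ n))\<^sup>2 / real n))"
    using diverging_weights_exist[OF _ sm] by auto
  define k where "k = (\<lambda>n. a n / real n)"
  have k: "0 \<le> k n" for n using a by (simp add: k_def)
  define A where "A = (\<Sum>n. a n * ((h2_norm (\<lambda>z. \<phi> z ^ n))\<^sup>2 / real n))"
  define c where "c = (\<lambda>n. taylor_coeff (\<lambda>z. \<phi> z ^ n))"
  \<comment> \<open>The number of functions and their truncation degree both grow with
    \<open>N\<close>. All real parts in the exponent are nonnegative, so a bound by the first
    \<open>M\<close> terms persists for every \<open>N >= M\<close>.\<close>
  define W where "W = (\<lambda>N z. exp (- (\<Sum>n<N. of_real (k n) * majorant_poly (c n) N z)))"
  have W_le: "cmod (W N z) \<le> exp (- (\<Sum>n<M. k n * (cmod (\<Sum>j<N. c n j * z ^ j))\<^sup>2))"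
    if "z \<in> disk" "M \<le> N" for N z M
  proof -
    have "(\<Sum>n<M. k n * (cmod (\<Sum>j<N. c n j * z ^ j))\<^sup>2) \<le> (\<Sum>n<N. k n * (cmod (\<Sum>j<N. c n j * z ^ j))\<^sup>2)"
      using k that by (intro sum_mono2) auto
    also have "\<dots> \<le> (\<Sum>n<N. k n * Re (majorant_poly (c n) N z))"
      using that k by (intro sum_mono mult_left_mono Re_majorant_poly_ge) auto
    finally show ?thesis by (simp add: W_def)
  qed
  have W_le1: "cmod (W N z) \<le> 1" if "z \<in> disk" for N z
    using W_le[OF that, of 0 N] by simp
  have W0: "exp (- A) \<le> cmod (W N 0)" for N
  proof -
    have "(\<Sum>n<N. k n * (\<Sum>j<N. (cmod (c n j))\<^sup>2)) \<le> (\<Sum>n<N. k n * (h2_norm (\<lambda>z. \<phi> z ^ n))\<^sup>2)"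
      unfolding c_def
      by (intro sum_mono mult_left_mono k sum_taylor_coeff_le_h2_norm power_self_map_in_H2 \<phi>)
    also have "\<dots> = (\<Sum>n<N. a n * ((h2_norm (\<lambda>z. \<phi> z ^ n))\<^sup>2 / real n))"
      by (simp add: k_def)
    also have "\<dots> \<le> A"
      unfolding A_def using a by (intro sum_le_suminf sa) auto
    finally show ?thesis by (simp add: W_def majorant_poly_0)
  qed
  obtain w \<rho> where w: "w holomorphic_on disk" and \<rho>: "strict_mono (\<rho> :: nat \<Rightarrow> nat)"
    and lim: "\<And>z. z \<in> disk \<Longrightarrow> (\<lambda>n. W (\<rho> n) z) \<longlonglongrightarrow> w z"
  proof (rule Montel[of disk "range W" W])
    show "h holomorphic_on disk" if "h \<in> range W" for h
      using that by (auto simp: W_def intro!: holomorphic_intros)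
    show "\<exists>B. \<forall>h\<in>range W. \<forall>z\<in>K. cmod (h z) \<le> B" if "compact K" "K \<subseteq> disk" for K
      using that W_le1 by (intro exI[of _ 1]) auto
  qed auto
  have "exp (- A) \<le> cmod (w 0)"
    using tendsto_norm[OF lim[of 0]] W0 by (intro LIMSEQ_le_const[of "\<lambda>n. cmod (W (\<rho> n) 0)"]) auto
  then have "w 0 \<noteq> 0"
    by (metis exp_gt_zero norm_zero not_le)
  moreover have w_le: "cmod (w z) \<le> exp (- (\<Sum>n<M. a n / real n * ((cmod (\<phi> z))\<^sup>2) ^ n))" if z: "z \<in> disk" for z M
  proof (rule LIMSEQ_le)
    show "(\<lambda>i. cmod (W (\<rho> i) z)) \<longlonglongrightarrow> cmod (w z)"
      by (intro tendsto_norm lim z)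
    have "(\<lambda>N. \<Sum>j<N. c n j * z ^ j) \<longlonglongrightarrow> \<phi> z ^ n" for n
      using taylor_sums[of "\<lambda>z. \<phi> z ^ n" z] \<phi> z unfolding c_def sums_def
      by (auto intro!: holomorphic_intros)
    then have "(\<lambda>i. \<Sum>j<\<rho> i. c n j * z ^ j) \<longlonglongrightarrow> \<phi> z ^ n" for n
      using LIMSEQ_subseq_LIMSEQ[OF _ \<rho>] by (fastforce simp: o_def)
    then have "(\<lambda>i. exp (- (\<Sum>n<M. k n * (cmod (\<Sum>j<\<rho> i. c n j * z ^ j))\<^sup>2))) \<longlonglongrightarrow>
      exp (- (\<Sum>n<M. k n * (cmod (\<phi> z ^ n))\<^sup>2))"
      by (intro tendsto_intros)
    moreover have "(cmod (\<phi> z ^ n))\<^sup>2 = ((cmod (\<phi> z))\<^sup>2) ^ n" for n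
      by (simp add: norm_power power_even_eq power_commutes mult.commute flip: power_mult)
    ultimately show "(\<lambda>i. exp (- (\<Sum>n<M. k n * (cmod (\<Sum>j<\<rho> i. c n j * z ^ j))\<^sup>2))) \<longlonglongrightarrow>
      exp (- (\<Sum>n<M. a n / real n * ((cmod (\<phi> z))\<^sup>2) ^ n))"
      by (simp add: k_def)
    show "\<exists>N. \<forall>i\<ge>N. cmod (W (\<rho> i) z) \<le> exp (- (\<Sum>n<M. k n * (cmod (\<Sum>j<\<rho> i. c n j * z ^ j))\<^sup>2))"
      using W_le[OF z] seq_suble[OF \<rho>] by (meson order_trans)
  qed
  moreover have "\<exists>C>0. \<forall>z\<in>disk. cmod (w z) \<le> C * (1 - (cmod (\<phi> z))\<^sup>2) ^ L" for L
  proof -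
    obtain C where C: "0 < C" "\<And>x u. 0 \<le> x \<Longrightarrow> x < 1 \<Longrightarrow>
        (\<And>M. u \<le> exp (- (\<Sum>n<M. a n / real n * x ^ n))) \<Longrightarrow> u \<le> C * (1 - x) ^ L"
      using log_weight_superpolynomial[OF a, of L] by blast
    have "cmod (w z) \<le> C * (1 - (cmod (\<phi> z))\<^sup>2) ^ L" if z: "z \<in> disk" for z
    proof (rule C(2))
      have "cmod (\<phi> z) < 1" using \<phi>(2) z by force
      then show "(cmod (\<phi> z))\<^sup>2 < 1" by (simp add: abs_square_less_1)
    qed (use w_le[OF z] in auto)
    with C(1) show ?thesis by blast
  qed
  ultimately show ?thesis using that w by blast
qed

text \<open>Bounding each coefficient by the norm gives a worse power of \<open>1 - cmod z\<close>
  than Cauchy-Schwarz, but the weight beats every power. The case \<open>n = 0\<close> is the growth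
  bound for \<open>f\<close> itself.\<close>

lemma taylor_tail_le:
  assumes f: "f \<in> H2" and z: "z \<in> disk"
  shows "cmod (f z - (\<Sum>i<n. taylor_coeff f i * z ^ i)) \<le> h2_norm f * (cmod z ^ n / (1 - cmod z))"
proof -
  have z1: "cmod z < 1" using z by simp
  have "(\<lambda>i. taylor_coeff f (i + n) * z ^ (i + n)) sums (f z - (\<Sum>i<n. taylor_coeff f i * z ^ i))"
    by (rule sums_split_initial_segment[OF taylor_sums[OF H2_D(1)[OF f] z]])
  moreover have geo: "(\<lambda>i. h2_norm f * cmod z ^ n * cmod z ^ i) sums (h2_norm f * cmod z ^ n * (1 / (1 - cmod z)))"
    using z1 by (intro sums_mult geometric_sums) auto
  moreover have "cmod (taylor_coeff f (i + n) * z ^ (i + n)) \<le> h2_norm f * cmod z ^ n * cmod z ^ i" for i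
    using mult_right_mono[OF taylor_coeff_le_h2_norm[OF f, of "i + n"], of "cmod z ^ (i + n)"]
    by (simp add: norm_mult norm_power power_add mult_ac)
  ultimately show ?thesis
    using norm_suminf_le[of "\<lambda>i. taylor_coeff f (i + n) * z ^ (i + n)" "\<lambda>i. h2_norm f * cmod z ^ n * cmod z ^ i"]
    by (simp add: sums_iff)
qed

text \<open>With \<open>t = n * (1 - y)\<close> one has \<open>y ^ n <= exp (- t)\<close> and
  \<open>t ^ L <= fact L * exp t\<close>.\<close>

lemma power_mult_power_le:
  fixes y :: real
  assumes "0 \<le> y" "y \<le> 1"
  shows "real n ^ L * ((1 - y) ^ L * y ^ n) \<le> fact L"
proof -
  have ge: "x ^ L / fact L \<le> exp x" if "0 \<le> x" for x :: real
  proof -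
    have "(\<Sum>n\<in>{L}. inverse (fact n) * x ^ n) \<le> (\<Sum>n. inverse (fact n) * x ^ n)"
      using that summable_exp[of x] by (intro sum_le_suminf) auto
    then show ?thesis by (simp add: exp_def divide_inverse mult.commute)
  qed
  have "y \<le> exp (- (1 - y))"
    using exp_ge_add_one_self[of "- (1 - y)"] by simp
  then have "y ^ n \<le> exp (- (1 - y)) ^ n"
    using assms by (intro power_mono)
  then have yn: "y ^ n \<le> exp (- (real n * (1 - y)))"
    by (simp flip: exp_of_nat_mult add: algebra_simps)
  have "real n ^ L * ((1 - y) ^ L * y ^ n) = (real n * (1 - y)) ^ L * y ^ n"
    by (simp add: power_mult_distrib)
  also have "\<dots> \<le> (fact L * exp (real n * (1 - y))) * exp (- (real n * (1 - y)))"
    using assms ge[of "real n * (1 - y)"] yn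
    by (intro mult_mono) (auto simp: divide_le_eq mult.commute)
  also have "\<dots> = fact L" by (simp flip: exp_add add: mult.assoc)
  finally show ?thesis .
qed

section \<open>Singular numbers and compactness\<close>

lemma wcomp_holomorphic:
  assumes "w holomorphic_on disk" "\<phi> holomorphic_on disk" "\<phi> ` disk \<subseteq> disk" "f holomorphic_on disk"
  shows "wcomp w \<phi> f holomorphic_on disk"
  unfolding wcomp_def
  using assms holomorphic_on_compose_gen[OF assms(2,4,3)]
  by (auto simp: o_def intro!: holomorphic_intros)

text \<open>A real \<open>Sup\<close> is informative only for a set bounded above, so boundedness of
  both operators enters before the value at the zero function can serve as a lower bound.\<close>

lemma op_norm_H2_diff_nonneg:
  assumes "bounded_on_H2 T" "bounded_on_H2 R"
  shows "0 \<le> op_norm_H2 (\<lambda>f z. T f z - R f z)"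
proof -
  from assms obtain C D where T: "\<And>f. f \<in> H2 \<Longrightarrow> T f \<in> H2" "\<And>f. f \<in> H2 \<Longrightarrow> h2_norm (T f) \<le> C * h2_norm f"
    and R: "\<And>f. f \<in> H2 \<Longrightarrow> R f \<in> H2" "\<And>f. f \<in> H2 \<Longrightarrow> h2_norm (R f) \<le> D * h2_norm f"
    unfolding bounded_on_H2_def by blast
  let ?S = "{h2_norm (\<lambda>z. T f z - R f z) | f. f \<in> H2 \<and> h2_norm f \<le> 1}"
  \<comment> \<open>The constants of boundedness carry no sign, hence the detour through absolute
    values and squares.\<close>
  have sq: "(h2_norm g)\<^sup>2 \<le> E\<^sup>2" if "g \<in> H2" "h2_norm g \<le> E * h2_norm f" "f \<in> H2" "h2_norm f \<le> 1" for f g E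
  proof -
    have "h2_norm g \<le> \<bar>E\<bar> * h2_norm f"
      using that h2_norm_nonneg[OF that(3)] by (meson abs_ge_self mult_right_mono order_trans)
    also have "\<dots> \<le> \<bar>E\<bar>" using that by (simp add: mult_left_le)
    finally show ?thesis using h2_norm_nonneg[OF that(1)] by (simp add: abs_le_square_iff[symmetric])
  qed
  have "bdd_above ?S"
  proof (rule bdd_aboveI[of _ "sqrt (2 * C\<^sup>2 + 2 * D\<^sup>2)"])
    fix x assume "x \<in> ?S"
    then obtain f where f: "f \<in> H2" "h2_norm f \<le> 1" and x: "x = h2_norm (\<lambda>z. T f z - R f z)" by blast
    have "x\<^sup>2 \<le> 2 * C\<^sup>2 + 2 * D\<^sup>2"
      unfolding x using H2_diff(2)[OF T(1) R(1), OF f(1) f(1)]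
        sq[OF T(1)[OF f(1)] T(2)[OF f(1)] f] sq[OF R(1)[OF f(1)] R(2)[OF f(1)] f]
      by linarith
    then show "x \<le> sqrt (2 * C\<^sup>2 + 2 * D\<^sup>2)" by (rule real_le_rsqrt)
  qed
  moreover have "h2_norm (\<lambda>z. T (\<lambda>z. 0) z - R (\<lambda>z. 0) z) \<in> ?S"
    using zero_in_H2 h2_norm_zero by force
  ultimately have "h2_norm (\<lambda>z. T (\<lambda>z. 0) z - R (\<lambda>z. 0) z) \<le> op_norm_H2 (\<lambda>f z. T f z - R f z)"
    unfolding op_norm_H2_def by (intro cSup_upper)
  moreover have "0 \<le> h2_norm (\<lambda>z. T (\<lambda>z. 0) z - R (\<lambda>z. 0) z)"
    by (intro h2_norm_nonneg H2_diff T R zero_in_H2)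
  ultimately show ?thesis by linarith
qed

lemma zero_operator: "bounded_on_H2 (\<lambda>f z. 0)" "rank_le_H2 n (\<lambda>f z. 0)"
proof -
  show "bounded_on_H2 (\<lambda>f z. 0)"
    using zero_in_H2 h2_norm_zero
    by (auto simp: bounded_on_H2_def linear_on_H2_def intro!: exI[of _ 0])
  show "rank_le_H2 n (\<lambda>f z. 0)"
    unfolding rank_le_H2_def by (intro exI[of _ "\<lambda>_ _. 0"]) auto
qed

lemma sing_num_nonneg:
  assumes "bounded_on_H2 T"
  shows "0 \<le> sing_num T n"
  unfolding sing_num_def
  by (rule cInf_greatest) (use zero_operator op_norm_H2_diff_nonneg[OF assms] in blast)+

lemma sing_num_le:
  assumes T: "bounded_on_H2 T" and R: "bounded_on_H2 R" "rank_le_H2 n R"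
    and K: "\<And>f. f \<in> H2 \<Longrightarrow> h2_norm f \<le> 1 \<Longrightarrow> h2_norm (\<lambda>z. T f z - R f z) \<le> K"
  shows "sing_num T n \<le> K"
proof -
  have "sing_num T n \<le> op_norm_H2 (\<lambda>f z. T f z - R f z)"
    unfolding sing_num_def
  proof (rule cInf_lower)
    show "bdd_below {op_norm_H2 (\<lambda>f z. T f z - R f z) |R. bounded_on_H2 R \<and> rank_le_H2 n R}"
      by (rule bdd_belowI[of _ 0]) (use op_norm_H2_diff_nonneg[OF T] in blast)
  qed (use R in blast)
  also have "\<dots> \<le> K"
    unfolding op_norm_H2_def
    by (rule cSup_least) (use K zero_in_H2 h2_norm_zero in force)+
  finally show ?thesis .
qed

section \<open>Weighted composition operators with a rapidly decaying weight\<close>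

locale rapid_weight =
  fixes w \<phi> :: "complex \<Rightarrow> complex"
  assumes w: "w holomorphic_on disk"
    and \<phi>: "\<phi> holomorphic_on disk" "\<phi> ` disk \<subseteq> disk"
    and decay: "\<And>L. \<exists>C>0. \<forall>z\<in>disk. cmod (w z) \<le> C * (1 - (cmod (\<phi> z))\<^sup>2) ^ L"
begin

lemma \<phi>_disk: "z \<in> disk \<Longrightarrow> \<phi> z \<in> disk"
  using \<phi>(2) by blast

lemma \<phi>_lt_1: "z \<in> disk \<Longrightarrow> cmod (\<phi> z) < 1"
  using \<phi>_disk by simp

lemma decay_linear: "\<exists>C>0. \<forall>z\<in>disk. cmod (w z) \<le> C * (1 - cmod (\<phi> z)) ^ L"
proof -
  obtain C where C: "C > 0" "\<And>z. z \<in> disk \<Longrightarrow> cmod (w z) \<le> C * (1 - (cmod (\<phi> z))\<^sup>2) ^ L"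
    using decay[of L] by blast
  have "cmod (w z) \<le> (C * 2 ^ L) * (1 - cmod (\<phi> z)) ^ L" if z: "z \<in> disk" for z
  proof -
    let ?y = "cmod (\<phi> z)"
    have y: "0 \<le> ?y" "?y < 1" using \<phi>_lt_1[OF z] by auto
    have "1 - ?y\<^sup>2 = (1 + ?y) * (1 - ?y)" by (simp add: power2_eq_square algebra_simps)
    also have "\<dots> \<le> 2 * (1 - ?y)" using y by (intro mult_right_mono) auto
    finally have "(1 - ?y\<^sup>2) ^ L \<le> (2 * (1 - ?y)) ^ L"
      using y by (intro power_mono) (auto simp: power_le_one)
    then have "C * (1 - ?y\<^sup>2) ^ L \<le> C * (2 * (1 - ?y)) ^ L"
      using C(1) by (intro mult_left_mono) auto
    then have "cmod (w z) \<le> C * (2 * (1 - ?y)) ^ L"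
      using C(2)[OF z] by (rule order_trans[rotated])
    then show ?thesis
      unfolding power_mult_distrib by (simp only: mult.assoc)
  qed
  then show ?thesis using C(1) by (intro exI[of _ "C * 2 ^ L"]) auto
qed

text \<open>One constant serves all \<open>h\<close>, \<open>n\<close> and \<open>K\<close>:
  boundedness of the operator is the case \<open>n = 0\<close>, and Taylor tails of order
  \<open>n\<close> give the decay of the singular numbers.\<close>

lemma wcomp_growth_bound:
  "\<exists>C>0. \<forall>h n K. h holomorphic_on disk \<longrightarrow> 0 \<le> K \<longrightarrow>
      (\<forall>\<zeta>\<in>disk. cmod (h \<zeta>) \<le> K * (cmod \<zeta> ^ n / (1 - cmod \<zeta>))) \<longrightarrow>
      (\<forall>z\<in>disk. real n ^ L * cmod (wcomp w \<phi> h z) \<le> C * K)"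
proof -
  \<comment> \<open>One of the \<open>Suc L\<close> powers cancels the denominator
    \<open>1 - cmod \<zeta>\<close>; the other \<open>L\<close> are traded for the factor
    \<open>real n ^ L\<close>.\<close>
  obtain C where C: "C > 0" "\<And>z. z \<in> disk \<Longrightarrow> cmod (w z) \<le> C * (1 - cmod (\<phi> z)) ^ Suc L"
    using decay_linear[of "Suc L"] by blast
  have "real n ^ L * cmod (wcomp w \<phi> h z) \<le> C * fact L * K"
    if K: "0 \<le> K" and h: "\<And>\<zeta>. \<zeta> \<in> disk \<Longrightarrow> cmod (h \<zeta>) \<le> K * (cmod \<zeta> ^ n / (1 - cmod \<zeta>))" and z: "z \<in> disk"
    for h n K z
  proof -
    let ?y = "cmod (\<phi> z)"
    have y: "0 \<le> ?y" "?y < 1" using \<phi>_lt_1[OF z] by auto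
    have "cmod (wcomp w \<phi> h z) \<le> (C * (1 - ?y) ^ Suc L) * (K * (?y ^ n / (1 - ?y)))"
      unfolding wcomp_def norm_mult using C(1) y K
      by (intro mult_mono C(2) h z \<phi>_disk) auto
    also have "\<dots> = C * K * ((1 - ?y) ^ L * ?y ^ n)"
      using y by simp
    finally have "real n ^ L * cmod (wcomp w \<phi> h z) \<le> real n ^ L * (C * K * ((1 - ?y) ^ L * ?y ^ n))"
      by (intro mult_left_mono) auto
    also have "\<dots> = C * K * (real n ^ L * ((1 - ?y) ^ L * ?y ^ n))" by simp
    also have "\<dots> \<le> C * K * fact L"
      using C(1) K y by (intro mult_left_mono power_mult_power_le) auto
    finally show ?thesis by (simp add: mult_ac)
  qed
  then show ?thesis
    using C(1) by (intro exI[of _ "C * fact L"]) auto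
qed

lemma wcomp_bounded: "bounded_on_H2 (wcomp w \<phi>)"
proof -
  obtain C where C: "C > 0" and bd: "\<And>h n K z. h holomorphic_on disk \<Longrightarrow> 0 \<le> K \<Longrightarrow>
      (\<And>\<zeta>. \<zeta>\<in>disk \<Longrightarrow> cmod (h \<zeta>) \<le> K * (cmod \<zeta> ^ n / (1 - cmod \<zeta>))) \<Longrightarrow> z \<in> disk \<Longrightarrow>
      real n ^ 0 * cmod (wcomp w \<phi> h z) \<le> C * K"
    using wcomp_growth_bound[of 0] by metis
  have "cmod (wcomp w \<phi> f z) \<le> C * h2_norm f" if "f \<in> H2" "z \<in> disk" for f z
    using bd[of f "h2_norm f" 0 z] taylor_tail_le[OF that(1), of _ 0] that
    by (simp add: H2_D h2_norm_nonneg)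
  then have "wcomp w \<phi> f \<in> H2 \<and> h2_norm (wcomp w \<phi> f) \<le> C * h2_norm f" if "f \<in> H2" for f
    using that C bounded_in_H2[OF wcomp_holomorphic[OF w \<phi> H2_D(1)[OF that]], of "C * h2_norm f"]
    by (simp add: h2_norm_nonneg)
  then show ?thesis
    unfolding bounded_on_H2_def linear_on_H2_def by (auto simp: wcomp_def algebra_simps)
qed

text \<open>This is the operator applied to the Taylor polynomial of \<open>f\<close>, expanded so
  that rank at most \<open>n\<close> and linearity in the coefficients are visible.\<close>

definition taylor_section :: "nat \<Rightarrow> (complex \<Rightarrow> complex) \<Rightarrow> complex \<Rightarrow> complex" where
  "taylor_section n f z = (\<Sum>i<n. taylor_coeff f i * (w z * \<phi> z ^ i))"

lemma taylor_section_bounded: "bounded_on_H2 (taylor_section n)"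
proof -
  obtain C where C: "C > 0" "\<And>z. z \<in> disk \<Longrightarrow> cmod (w z) \<le> C"
    using decay[of 0] by auto
  have "taylor_section n f \<in> H2 \<and> h2_norm (taylor_section n f) \<le> real n * C * h2_norm f" if f: "f \<in> H2" for f
  proof -
    have "taylor_section n f holomorphic_on disk"
      unfolding taylor_section_def by (intro holomorphic_intros w \<phi>)
    moreover have "cmod (taylor_section n f z) \<le> real n * C * h2_norm f" if z: "z \<in> disk" for z
    proof -
      have "cmod (taylor_section n f z) \<le> (\<Sum>i<n. h2_norm f * (C * 1))"
        unfolding taylor_section_def
      proof (rule order_trans[OF norm_sum sum_mono])
        fix i
        show "cmod (taylor_coeff f i * (w z * \<phi> z ^ i)) \<le> h2_norm f * (C * 1)"
          unfolding norm_mult norm_power using \<phi>_lt_1[OF z] C(1) h2_norm_nonneg[OF f]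
          by (intro mult_mono taylor_coeff_le_h2_norm[OF f] C(2) z power_le_one) auto
      qed
      then show ?thesis by (simp add: mult_ac)
    qed
    ultimately show ?thesis
      using bounded_in_H2[of "taylor_section n f" "real n * C * h2_norm f"] C(1) h2_norm_nonneg[OF f] by simp
  qed
  moreover have "linear_on_H2 (taylor_section n)"
    unfolding linear_on_H2_def taylor_section_def
    by (simp add: taylor_coeff_lincomb H2_D sum_distrib_left flip: sum.distrib) (simp add: algebra_simps)
  ultimately show ?thesis
    unfolding bounded_on_H2_def by blast
qed

lemma taylor_section_rank: "rank_le_H2 n (taylor_section n)"
  unfolding rank_le_H2_def taylor_section_def
  by (intro exI[of _ "\<lambda>i z. w z * \<phi> z ^ i"] exI[of _ taylor_coeff]) auto

lemma sing_num_decay: "\<exists>C>0. \<forall>n. real n ^ L * sing_num (wcomp w \<phi>) n \<le> C"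
proof -
  obtain C where C: "C > 0" and bd: "\<And>h n K z. h holomorphic_on disk \<Longrightarrow> 0 \<le> K \<Longrightarrow>
      (\<And>\<zeta>. \<zeta>\<in>disk \<Longrightarrow> cmod (h \<zeta>) \<le> K * (cmod \<zeta> ^ n / (1 - cmod \<zeta>))) \<Longrightarrow> z \<in> disk \<Longrightarrow>
      real n ^ L * cmod (wcomp w \<phi> h z) \<le> C * K"
    using wcomp_growth_bound[of L] by metis
  have "real n ^ L * sing_num (wcomp w \<phi>) n \<le> C" for n
  proof (cases "real n ^ L = 0")
    \<comment> \<open>This is \<open>n = 0\<close> with \<open>L > 0\<close>; the product is then 0
      whatever the singular number is.\<close>
    case True
    then show ?thesis using C by (simp del: power_eq_0_iff)
  next
    case False
    then have nL: "0 < real n ^ L" by (simp add: zero_less_power)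
    have "sing_num (wcomp w \<phi>) n \<le> C / real n ^ L"
    proof (rule sing_num_le[OF wcomp_bounded taylor_section_bounded taylor_section_rank])
      fix f assume f: "f \<in> H2" "h2_norm f \<le> 1"
      \<comment> \<open>Subtracting \<open>taylor_section n\<close> amounts to applying the operator
        to the Taylor tail, to which the growth bound applies.\<close>
      define h where "h = (\<lambda>\<zeta>. f \<zeta> - (\<Sum>i<n. taylor_coeff f i * \<zeta> ^ i))"
      have h: "h holomorphic_on disk"
        unfolding h_def by (intro holomorphic_intros H2_D f)
      have eq: "(\<lambda>z. wcomp w \<phi> f z - taylor_section n f z) = wcomp w \<phi> h"
        by (simp add: fun_eq_iff wcomp_def taylor_section_def h_def right_diff_distrib sum_distrib_left mult_ac)
      have "cmod (wcomp w \<phi> h z) \<le> C / real n ^ L" if z: "z \<in> disk" for z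
      proof -
        have "real n ^ L * cmod (wcomp w \<phi> h z) \<le> C * h2_norm f"
          by (rule bd[OF h h2_norm_nonneg[OF f(1)] _ z]) (use taylor_tail_le[OF f(1)] in \<open>simp add: h_def\<close>)
        also have "\<dots> \<le> C" using f(2) C by simp
        finally show ?thesis using nL by (simp add: pos_le_divide_eq mult.commute)
      qed
      then show "h2_norm (\<lambda>z. wcomp w \<phi> f z - taylor_section n f z) \<le> C / real n ^ L"
        unfolding eq using C by (intro bounded_in_H2 wcomp_holomorphic w \<phi> h) auto
    qed
    then show ?thesis using nL by (simp add: pos_le_divide_eq mult.commute)
  qed
  with C show ?thesis by blast
qed

lemma sing_num_powr_summable:
  assumes "0 < p"
  shows "summable (\<lambda>n. sing_num (wcomp w \<phi>) n powr p)"
proof -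
  \<comment> \<open>The terms are then dominated by a multiple of \<open>n\<close> to the power
    \<open>- L * p\<close>, with \<open>L * p > 1\<close>.\<close>
  obtain L :: nat where "2 / p < real L" using reals_Archimedean2 by blast
  then have L: "1 < real L * p" using assms by (simp add: field_simps)
  obtain C where C: "C > 0" "\<And>n. real n ^ L * sing_num (wcomp w \<phi>) n \<le> C"
    using sing_num_decay[of L] by blast
  have "summable (\<lambda>n. C powr p * real n powr (- (real L * p)))"
    using L by (intro summable_mult) (simp add: summable_real_powr_iff)
  then show ?thesis
  proof (rule summable_comparison_test'[where N = 1])
    fix n :: nat assume n: "1 \<le> n"
    have "sing_num (wcomp w \<phi>) n \<le> C * real n powr (- real L)"
      using C(2)[of n] n by (simp add: powr_minus powr_realpow field_simps)
    then have "sing_num (wcomp w \<phi>) n powr p \<le> (C * real n powr (- real L)) powr p"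
      using assms by (intro powr_mono2 sing_num_nonneg wcomp_bounded) auto
    also have "\<dots> = C powr p * real n powr (- (real L * p))"
      using C(1) by (simp add: powr_mult powr_powr)
    finally show "norm (sing_num (wcomp w \<phi>) n powr p) \<le> C powr p * real n powr (- (real L * p))"
      by simp
  qed
qed

text \<open>Montel's theorem gives a locally uniform limit of a subsequence. Where \<phi> stays in a
  smaller disk this convergence suffices; elsewhere the decay of \<open>w\<close> makes both images
  small.\<close>

lemma wcomp_compact: "compact_on_H2 (wcomp w \<phi>)"
  unfolding compact_on_H2_def
proof (intro conjI wcomp_bounded allI impI)
  fix f :: "nat \<Rightarrow> complex \<Rightarrow> complex"
  assume "(\<forall>n. f n \<in> H2) \<and> (\<exists>B. \<forall>n. h2_norm (f n) \<le> B)"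
  then obtain B where f: "\<And>n. f n \<in> H2" and B: "\<And>n. h2_norm (f n) \<le> B" by blast
  have B0: "0 \<le> B" using B[of 0] h2_norm_nonneg[OF f[of 0]] by linarith
  have growth: "cmod (h z) \<le> B / (1 - cmod z)" if "h \<in> range f" "z \<in> disk" for h z
  proof -
    from that obtain n where h: "h = f n" by auto
    have "cmod (h z) \<le> h2_norm (f n) * (1 / (1 - cmod z))"
      using taylor_tail_le[OF f that(2), of n 0] by (simp add: h)
    also have "\<dots> \<le> B * (1 / (1 - cmod z))"
      using that(2) by (intro mult_right_mono B) auto
    finally show ?thesis by simp
  qed
  obtain g r where g: "g holomorphic_on disk" and r: "strict_mono (r :: nat \<Rightarrow> nat)"
    and ptw: "\<And>z. z \<in> disk \<Longrightarrow> (\<lambda>n. f (r n) z) \<longlonglongrightarrow> g z"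
    and unif: "\<And>K. compact K \<Longrightarrow> K \<subseteq> disk \<Longrightarrow> uniform_limit K (f \<circ> r) g sequentially"
  proof (rule Montel[of disk "range f" f])
    show "h holomorphic_on disk" if "h \<in> range f" for h
      using that f H2_D(1) by auto
    show "\<exists>D. \<forall>h\<in>range f. \<forall>z\<in>K. cmod (h z) \<le> D" if K: "compact K" "K \<subseteq> disk" for K
    proof (cases "K = {}")
      case False
      then obtain x where x: "x \<in> K" "\<And>y. y \<in> K \<Longrightarrow> cmod y \<le> cmod x"
        using continuous_attains_sup[OF K(1), of cmod] by (auto intro: continuous_intros)
      have "cmod (h z) \<le> B / (1 - cmod x)" if "h \<in> range f" "z \<in> K" for h z
      proof -
        have "cmod (h z) \<le> B / (1 - cmod z)" using that K by (intro growth) auto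
        also have "\<dots> \<le> B / (1 - cmod x)"
          using B0 x K that by (intro divide_left_mono mult_pos_pos) force+
        finally show ?thesis .
      qed
      then show ?thesis by blast
    qed auto
  qed auto
  \<comment> \<open>Only this growth of \<open>g\<close> is used, so its membership in
    \<open>H2\<close> need not be checked.\<close>
  have g_growth: "cmod (g z) \<le> B / (1 - cmod z)" if "z \<in> disk" for z
    using growth[OF _ that] by (intro LIMSEQ_le_const2[OF tendsto_norm[OF ptw[OF that]]]) auto
  have hol: "wcomp w \<phi> g holomorphic_on disk" by (intro wcomp_holomorphic w \<phi> g)
  have gH2: "wcomp w \<phi> g \<in> H2"
  proof -
    obtain C where C: "C > 0" "\<And>z. z \<in> disk \<Longrightarrow> cmod (w z) \<le> C * (1 - cmod (\<phi> z)) ^ 1"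
      using decay_linear[of 1] by blast
    have "cmod (wcomp w \<phi> g z) \<le> C * B" if z: "z \<in> disk" for z
    proof -
      have "cmod (wcomp w \<phi> g z) \<le> (C * (1 - cmod (\<phi> z)) ^ 1) * (B / (1 - cmod (\<phi> z)))"
        unfolding wcomp_def norm_mult using \<phi>_lt_1[OF z] C(1)
        by (intro mult_mono C(2) g_growth z \<phi>_disk) auto
      then show ?thesis using \<phi>_lt_1[OF z] by simp
    qed
    then show ?thesis using C(1) B0 by (intro bounded_in_H2(1)[OF hol, of "C * B"]) auto
  qed
  define D where "D = (\<lambda>n z. wcomp w \<phi> (f (r n)) z - wcomp w \<phi> g z)"
  have D_hol: "D n holomorphic_on disk" for n
    unfolding D_def by (intro holomorphic_intros hol wcomp_holomorphic w \<phi> H2_D f)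
  have D_H2: "D n \<in> H2" for n
    unfolding D_def using wcomp_bounded f gH2 by (intro H2_diff) (auto simp: bounded_on_H2_def)
  obtain C0 where C0: "C0 > 0" "\<And>z. z \<in> disk \<Longrightarrow> cmod (w z) \<le> C0"
    using decay[of 0] by auto
  \<comment> \<open>One power cancels the growth of the functions; the second one supplies smallness
    near the boundary.\<close>
  obtain C where C: "C > 0" "\<And>z. z \<in> disk \<Longrightarrow> cmod (w z) \<le> C * (1 - cmod (\<phi> z)) ^ 2"
    using decay_linear[of 2] by blast
  have D_eq: "cmod (D n z) = cmod (w z) * cmod (f (r n) (\<phi> z) - g (\<phi> z))" for n z
    by (simp add: D_def wcomp_def norm_mult flip: right_diff_distrib)
  have near: "cmod (D n z) \<le> 2 * C * B * (1 - cmod (\<phi> z))" if z: "z \<in> disk" for n z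
  proof -
    let ?y = "cmod (\<phi> z)"
    have "cmod (f (r n) (\<phi> z) - g (\<phi> z)) \<le> B / (1 - ?y) + B / (1 - ?y)"
      by (rule order_trans[OF norm_triangle_ineq4 add_mono]) (use growth g_growth \<phi>_disk[OF z] in auto)
    then have "cmod (D n z) \<le> (C * (1 - ?y) ^ 2) * (2 * B / (1 - ?y))"
      unfolding D_eq using C(1) by (intro mult_mono C(2) z) auto
    also have "\<dots> = 2 * C * B * (1 - ?y)"
      using \<phi>_lt_1[OF z] by (simp add: power2_eq_square)
    finally show ?thesis .
  qed
  have "(\<lambda>n. h2_norm (D n)) \<longlonglongrightarrow> 0"
  proof (rule LIMSEQ_I)
    fix e :: real assume e: "0 < e"
    \<comment> \<open>Chosen so that the bound \<open>near\<close> is at most \<open>e / 2\<close>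
      outside radius \<rho>; the summand 1 covers the case \<open>B = 0\<close>.\<close>
    define \<rho> where "\<rho> = 1 - min 1 (e / (4 * C * B + 1))"
    have den: "0 < 4 * C * B + 1" using C(1) B0 by (simp add: add_nonneg_pos)
    have \<rho>: "\<rho> < 1" using e den by (simp add: \<rho>_def)
    have \<rho>e: "2 * C * B * (1 - \<rho>) \<le> e / 2"
    proof -
      have "2 * C * B * (1 - \<rho>) \<le> 2 * C * B * (e / (4 * C * B + 1))"
        using C(1) B0 by (intro mult_left_mono) (auto simp: \<rho>_def)
      also have "\<dots> \<le> e / 2" using den e by (simp add: field_simps)
      finally show ?thesis .
    qed
    have "uniform_limit (cball 0 \<rho>) (f \<circ> r) g sequentially"
      using \<rho> by (intro unif) auto
    then have "\<forall>\<^sub>F n in sequentially. \<forall>\<zeta>\<in>cball 0 \<rho>. dist ((f \<circ> r) n \<zeta>) (g \<zeta>) < e / (2 * C0)"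
      using e C0(1) by (simp add: uniform_limit_iff)
    then obtain N where N: "\<And>n \<zeta>. N \<le> n \<Longrightarrow> cmod \<zeta> \<le> \<rho> \<Longrightarrow> cmod (f (r n) \<zeta> - g \<zeta>) < e / (2 * C0)"
      unfolding eventually_sequentially by (auto simp: dist_norm Ball_def)
    have "cmod (D n z) \<le> e / 2" if "N \<le> n" and z: "z \<in> disk" for n z
    proof (cases "cmod (\<phi> z) \<le> \<rho>")
      case True
      have "cmod (D n z) \<le> C0 * (e / (2 * C0))"
        unfolding D_eq using C0(1) N[OF that(1) True] by (intro mult_mono C0(2) z) auto
      then show ?thesis using C0(1) by simp
    next
      case False
      have "cmod (D n z) \<le> 2 * C * B * (1 - cmod (\<phi> z))" by (rule near[OF z])
      also have "\<dots> \<le> 2 * C * B * (1 - \<rho>)"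
        using False C(1) B0 by (intro mult_left_mono) auto
      also note \<rho>e
      finally show ?thesis .
    qed
    then have "h2_norm (D n) \<le> e / 2" if "N \<le> n" for n
      using that e by (intro bounded_in_H2[OF D_hol]) auto
    then show "\<exists>no. \<forall>n\<ge>no. norm (h2_norm (D n) - 0) < e"
      using e h2_norm_nonneg[OF D_H2] by (intro exI[of _ N]) force
  qed
  then show "\<exists>r g. strict_mono r \<and> g \<in> H2 \<and> (\<lambda>n. h2_norm (\<lambda>z. wcomp w \<phi> (f (r n)) z - g z)) \<longlonglongrightarrow> 0"
    using r gH2 unfolding D_def by blast
qed

end

theorem theorem4p4:
  fixes \<phi> w\<^sub>0 :: "complex \<Rightarrow> complex"
  assumes "\<phi> holomorphic_on disk" and "\<phi> ` disk \<subseteq> disk"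
    and "w\<^sub>0 \<in> H2" and "\<exists>z\<in>disk. w\<^sub>0 z \<noteq> 0"
    and "hilbert_schmidt_H2 (wcomp w\<^sub>0 \<phi>)"
  shows "\<exists>w\<in>H2. (\<exists>z\<in>disk. w z \<noteq> 0) \<and> bounded_on_H2 (wcomp w \<phi>) \<and>
           (\<forall>p::real. 0 < p \<and> p < 2 \<longrightarrow> schatten_H2 p (wcomp w \<phi>))"
proof -
  have monomial: "(\<lambda>z. z ^ n) \<in> H2" for n
    using power_self_map_in_H2[of "\<lambda>z. z" n] by (auto intro: holomorphic_intros)
  \<comment> \<open>These functions are the images of the monomials, so their squared norms are the
    terms of the Hilbert-Schmidt sum.\<close>
  have "(\<lambda>z. w\<^sub>0 z * \<phi> z ^ n) \<in> H2" for n
    using assms(5) monomial[of n] by (auto simp: hilbert_schmidt_H2_def bounded_on_H2_def wcomp_def)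
  moreover have "summable (\<lambda>n. (h2_norm (\<lambda>z. w\<^sub>0 z * \<phi> z ^ n))\<^sup>2)"
    using assms(5) by (simp add: hilbert_schmidt_H2_def wcomp_def)
  ultimately have "summable (\<lambda>n. (h2_norm (\<lambda>z. \<phi> z ^ n))\<^sup>2 / real n)"
    by (intro log_energy_summable[OF assms(1,2,4)])
  then obtain w where w_hol: "w holomorphic_on disk" and w0: "w 0 \<noteq> 0" and w_decay:
    "\<And>L. \<exists>C>0. \<forall>z\<in>disk. cmod (w z) \<le> C * (1 - (cmod (\<phi> z))\<^sup>2) ^ L"
    using rapidly_decaying_weight[OF assms(1,2)] by blast
  interpret rapid_weight w \<phi>
    using w_hol w_decay assms(1,2) by unfold_locales
  \<comment> \<open>The zeroth power in the decay estimate says that \<open>w\<close> is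
    bounded.\<close>
  obtain C where "C > 0" "\<And>z. z \<in> disk \<Longrightarrow> cmod (w z) \<le> C"
    using decay[of 0] by auto
  then have "w \<in> H2"
    using w_hol by (intro bounded_in_H2[of w C]) auto
  moreover have "\<exists>z\<in>disk. w z \<noteq> 0"
    using w0 by (intro bexI[of _ 0]) auto
  ultimately show ?thesis
    using wcomp_bounded wcomp_compact sing_num_powr_summable by (auto simp: schatten_H2_def)
qed

end
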